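(* Let $\alpha=0$, $(\bar u,\bar\mu)\in\mathcal{D}$, $t\ge0$ and $0<\Delta x\le1$. Let $(u,\mu)(t)=T_t((\bar u,\bar\mu))$ and $(u_{\Delta x},\mu_{\Delta x})(t)=T_t\circ P_{\Delta x}((\bar u,\bar\mu))$. Then $$d_{\mathrm{BL}}(\mu(t),\mu_{\Delta x}(t))\le(1+2\sqrt2)\,t\,\bar F_\infty^{3/2}\Delta x^{1/2}+\Bigl(2+\tfrac12t^2+4e^{t/2}\Bigr)\bar F_\infty\,\Delta x.$$
   Context: Bounded Lipschitz metric: for nonnegative finite Borel measures $\lambda,\nu$ on $\mathbb{R}$, $d_{\mathrm{BL}}(\lambda,\nu)=\sup\{\int_{\mathbb{R}}\psi\,(d\lambda-d\nu):\|\psi\|_{\mathrm{BL}}\le1\}$, the supremum being over bounded Lipschitz functions $\psi$ on $\mathbb{R}$, with $\|\psi\|_{\mathrm{BL}}=\sup_x|\psi(x)|+\sup_{x\ne y}\frac{|\psi(x)-\psi(y)|}{|x-y|}$. Eulerian set $\mathcal{D}$. Let $\chi^\pm\in C^\infty(\mathbb{R})$ satisfy $\chi^++\chi^-=1$, $0\le\chi^\pm\le1$, $\mathrm{supp}\,\chi^+\subset(-1,\infty)$, $\mathrm{supp}\,\chi^-\subset(-\infty,1)$. Let $E_2=\{\bar f+a\chi^++b\chi^-:\bar f\in H^1(\mathbb{R}),a,b\in\mathbb{R}\}$ and $E_1^0=\{\bar f+a\chi^+:\bar f\in L^2(\mathbb{R}),a\in\mathbb{R}\}$ (independent of the choice of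 $\chi^\pm$). $\mathcal{D}$ is the set of pairs $(u,\mu)$ such that $u\in E_2$, $\mu$ is a nonnegative finite Radon measure on $\mathbb{R}$, $\mu((-\infty,\cdot))\in E_1^0$, and $d\mu_{\mathrm{ac}}=u_x^2\,dx$, where $\mu=\mu_{\mathrm{ac}}+\mu_{\mathrm{sing}}$ is the Lebesgue decomposition. Write $F(x)=\mu((-\infty,x))$, $F_{\mathrm{ac}}(x)=\mu_{\mathrm{ac}}((-\infty,x))$, $F_{\mathrm{sing}}(x)=\mu_{\mathrm{sing}}((-\infty,x))$, $F_\infty=\mu(\mathbb{R})$; $(u,\mu)$ and $(u,F)$ are used interchangeably. Bars denote initial data. Map $L$: $(\bar y,\bar U,\bar V)=L((\bar u,\bar\mu))$ with $\bar y(\xi)=\sup\{x\in\mathbb{R}: x+\bar\mu((-\infty,x))<\xi\}$, $\bar U(\xi)=\bar u(\bar y(\xi))$, $\bar V(\xi)=\xi-\bar y(\xi)$. Solution operator $S_t$ in the case $\alpha=0$ (conservative solutions): for $\bar X=(\bar y,\bar U,\bar V)$ in the image of $L$, $S_t(\bar X)=(y,U,V)(t)$ is the unique solution with initial data $\bar X$ of $y_t(t,\xi)=U(t,\xi)$, $U_t(t,\xi)=\tfrac12V(t,\xi)-\tfrac14V_\infty(t)$, $V(t,\xi)=\int_{-\infty}^\xi\bar V_\xi(\eta)\,d\eta=\bar V(\xi)$, with $V_\infty(t)=\lim_{\xi\to\infty}V(t,\xi)$. Map $M$: $(u,\mu)=M((y,U,V))$ with $u(x)=U(\xi)$ for any $\xi$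 with $x=y(\xi)$, and $\mu=y_\#(V_\xi\,d\xi)$ (pushforward). The solution operator is $T_t=M\circ S_t\circ L$. Projection $P_{\Delta x}:\mathcal{D}\to\mathcal{D}$: for $\Delta x>0$ let $x_j=j\Delta x$, $j\in\mathbb{Z}$, $f_j=f(x_j)$, $Df_{2j}=(f_{2j+2}-f_{2j})/(2\Delta x)$, $q_{2j}=\sqrt{DF_{\mathrm{ac},2j}-(Du_{2j})^2}$. Then $P_{\Delta x}((u,F))=(u_{\Delta x},F_{\Delta x})$, $F_{\Delta x}=F_{\Delta x,\mathrm{ac}}+F_{\Delta x,\mathrm{sing}}$, where for each $j$ (with either the upper or the lower signs chosen, consistently within $(x_{2j},x_{2j+2}]$; the choice is arbitrary): on $(x_{2j},x_{2j+1}]$: $u_{\Delta x}(x)=u_{2j}+(Du_{2j}\mp q_{2j})(x-x_{2j})$, $F_{\Delta x,\mathrm{ac}}(x)=F_{\mathrm{ac},2j}+(Du_{2j}\mp q_{2j})^2(x-x_{2j})$; on $(x_{2j+1},x_{2j+2}]$: $u_{\Delta x}(x)=u_{2j+2}+(Du_{2j}\pm q_{2j})(x-x_{2j+2})$, $F_{\Delta x,\mathrm{ac}}(x)=\tfrac12(F_{\mathrm{ac},2j+2}+F_{\mathrm{ac},2j})\mp2q_{2j}Du_{2j}\Delta x+(Du_{2j}\pm q_{2j})^2(x-x_{2j+1})$; on $(x_{2j},x_{2j+2}]$: $F_{\Delta x,\mathrm{sing}}(x)=F_{\mathrm{sing},2j+2}$. *)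

theory Defs
  imports "HOL-Analysis.Analysis"
begin

definition supp :: "(real \<Rightarrow> real) \<Rightarrow> real set" where
  "supp f = closure {x. f x \<noteq> 0}"

definition smooth :: "(real \<Rightarrow> real) \<Rightarrow> bool" where
  "smooth f \<longleftrightarrow> (\<forall>n x. ((deriv ^^ n) f) differentiable (at x))"

definition test_function :: "(real \<Rightarrow> real) \<Rightarrow> bool" where
  "test_function \<phi> \<longleftrightarrow> smooth \<phi> \<and> compact (supp \<phi>)"

definition locally_integrable :: "(real \<Rightarrow> real) \<Rightarrow> bool" where
  "locally_integrable f \<longleftrightarrow> (\<forall>a b. set_integrable lborel {a..b} f)"

definition has_weak_deriv :: "(real \<Rightarrow> real) \<Rightarrow> (real \<Rightarrow> real) \<Rightarrow> bool" where
  "has_weak_deriv f g \<longleftrightarrow> locally_integrable f \<and> locally_integrable g \<and>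
     (\<forall>\<phi>. test_function \<phi> \<longrightarrow>
        (LINT x|lborel. f x * deriv \<phi> x) = - (LINT x|lborel. g x * \<phi> x))"

text \<open>
  Weak derivatives are unique only almost everywhere; \<open>weak_deriv f\<close> is some representative.
  It is used only under Lebesgue integrals and as a Lebesgue density.
\<close>

definition weak_deriv :: "(real \<Rightarrow> real) \<Rightarrow> real \<Rightarrow> real" where
  "weak_deriv f = (SOME g. has_weak_deriv f g)"

definition L2 :: "(real \<Rightarrow> real) set" where
  "L2 = {f \<in> borel_measurable lborel. integrable lborel (\<lambda>x. (f x)\<^sup>2)}"

text \<open>
  Elements of \<open>H1\<close> are evaluated pointwise below, so each class is represented by its
  continuous representative.
\<close>

definition H1 :: "(real \<Rightarrow> real) set" where
  "H1 = {f \<in> L2. continuous_on UNIV f \<and> (\<exists>g \<in> L2. has_weak_deriv f g)}"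

definition cutoff_pair :: "(real \<Rightarrow> real) \<Rightarrow> (real \<Rightarrow> real) \<Rightarrow> bool" where
  "cutoff_pair \<chi>p \<chi>m \<longleftrightarrow> smooth \<chi>p \<and> smooth \<chi>m \<and> (\<forall>x. \<chi>p x + \<chi>m x = 1) \<and>
     (\<forall>x. 0 \<le> \<chi>p x \<and> \<chi>p x \<le> 1) \<and> (\<forall>x. 0 \<le> \<chi>m x \<and> \<chi>m x \<le> 1) \<and>
     supp \<chi>p \<subseteq> {-1<..} \<and> supp \<chi>m \<subseteq> {..<1}"

definition E2 :: "(real \<Rightarrow> real) \<Rightarrow> (real \<Rightarrow> real) \<Rightarrow> (real \<Rightarrow> real) set" where
  "E2 \<chi>p \<chi>m = {f. \<exists>g \<in> H1. \<exists>a b. f = (\<lambda>x. g x + a * \<chi>p x + b * \<chi>m x)}"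

definition E10 :: "(real \<Rightarrow> real) \<Rightarrow> (real \<Rightarrow> real) set" where
  "E10 \<chi>p = {f. \<exists>g \<in> L2. \<exists>a. f = (\<lambda>x. g x + a * \<chi>p x)}"

definition bl_function :: "(real \<Rightarrow> real) \<Rightarrow> bool" where
  "bl_function \<psi> \<longleftrightarrow> bounded (range \<psi>) \<and> (\<exists>C. C-lipschitz_on UNIV \<psi>)"

definition bl_norm :: "(real \<Rightarrow> real) \<Rightarrow> real" where
  "bl_norm \<psi> = (SUP x. \<bar>\<psi> x\<bar>) + (SUP (x, y) \<in> {(x, y). x \<noteq> y}. \<bar>\<psi> x - \<psi> y\<bar> / \<bar>x - y\<bar>)"

definition d_BL :: "real measure \<Rightarrow> real measure \<Rightarrow> real" where
  "d_BL \<mu> \<nu> = (SUP \<psi> \<in> {\<psi>. bl_function \<psi> \<and> bl_norm \<psi> \<le> 1}.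
                  (LINT x|\<mu>. \<psi> x) - (LINT x|\<nu>. \<psi> x))"

definition finite_borel_measure_on_R :: "real measure \<Rightarrow> bool" where
  "finite_borel_measure_on_R \<mu> \<longleftrightarrow> finite_measure \<mu> \<and> sets \<mu> = sets borel"

definition lebesgue_decomposition :: "real measure \<Rightarrow> real measure \<Rightarrow> real measure \<Rightarrow> bool" where
  "lebesgue_decomposition \<mu> \<alpha> \<sigma> \<longleftrightarrow>
     sets \<alpha> = sets borel \<and> sets \<sigma> = sets borel \<and>
     (\<forall>A \<in> sets borel. emeasure \<mu> A = emeasure \<alpha> A + emeasure \<sigma> A) \<and>
     absolutely_continuous lborel \<alpha> \<and>
     (\<exists>N \<in> sets borel. emeasure lborel N = 0 \<and> emeasure \<sigma> (- N) = 0)"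

definition ac_part :: "real measure \<Rightarrow> real measure" where
  "ac_part \<mu> = (THE \<alpha>. \<exists>\<sigma>. lebesgue_decomposition \<mu> \<alpha> \<sigma>)"

definition sing_part :: "real measure \<Rightarrow> real measure" where
  "sing_part \<mu> = (THE \<sigma>. \<exists>\<alpha>. lebesgue_decomposition \<mu> \<alpha> \<sigma>)"

text \<open>The distribution function is the left-continuous one, with \<open>(-\<infinity>, x)\<close> open at \<open>x\<close>.\<close>

definition dist_fun :: "real measure \<Rightarrow> real \<Rightarrow> real" where
  "dist_fun \<mu> x = measure \<mu> {..<x}"

definition measure_of_dist_fun :: "(real \<Rightarrow> real) \<Rightarrow> real measure" where
  "measure_of_dist_fun F = (THE \<mu>. finite_borel_measure_on_R \<mu> \<and> dist_fun \<mu> = F)"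

type_synonym eulerian = "(real \<Rightarrow> real) \<times> real measure"
type_synonym lagrangian = "(real \<Rightarrow> real) \<times> (real \<Rightarrow> real) \<times> (real \<Rightarrow> real)"

definition eulerian_set :: "(real \<Rightarrow> real) \<Rightarrow> (real \<Rightarrow> real) \<Rightarrow> eulerian set" where
  "eulerian_set \<chi>p \<chi>m = {(u, \<mu>).
     u \<in> E2 \<chi>p \<chi>m \<and>
     finite_borel_measure_on_R \<mu> \<and>
     dist_fun \<mu> \<in> E10 \<chi>p \<and>
     (\<exists>\<sigma>. lebesgue_decomposition \<mu> (density lborel (\<lambda>x. ennreal ((weak_deriv u x)\<^sup>2))) \<sigma>)}"

definition L_map :: "eulerian \<Rightarrow> lagrangian" where
  "L_map = (\<lambda>(u, \<mu>).
     let y = (\<lambda>\<xi>. Sup {x. x + measure \<mu> {..<x} < \<xi>})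
     in (y, (\<lambda>\<xi>. u (y \<xi>)), (\<lambda>\<xi>. \<xi> - y \<xi>)))"

text \<open>
  Conservative (\<open>\<alpha> = 0\<close>) solutions on the time interval \<open>[0, \<infinity>)\<close>; the first argument of
  \<open>y\<close>, \<open>U\<close>, \<open>V\<close> is time.
\<close>

definition lagrangian_solution ::
  "lagrangian \<Rightarrow> (real \<Rightarrow> real \<Rightarrow> real) \<Rightarrow> (real \<Rightarrow> real \<Rightarrow> real) \<Rightarrow> (real \<Rightarrow> real \<Rightarrow> real) \<Rightarrow> bool"
where
  "lagrangian_solution X y U V \<longleftrightarrow>
     (y 0, U 0, V 0) = X \<and>
     (\<forall>t \<ge> 0. \<forall>\<xi>.
        ((\<lambda>s. y s \<xi>) has_real_derivative U t \<xi>) (at t within {0..}) \<and>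
        ((\<lambda>s. U s \<xi>) has_real_derivative (1/2 * V t \<xi> - 1/4 * Lim at_top (V t)))
           (at t within {0..}) \<and>
        V t \<xi> = (LINT \<eta>:{..\<xi>}|lborel. weak_deriv (V 0) \<eta>))"

definition S_map :: "real \<Rightarrow> lagrangian \<Rightarrow> lagrangian" where
  "S_map t X = (THE Z. \<exists>y U V. lagrangian_solution X y U V \<and> Z = (y t, U t, V t))"

definition M_map :: "lagrangian \<Rightarrow> eulerian" where
  "M_map = (\<lambda>(y, U, V).
     (\<lambda>x. THE v. \<exists>\<xi>. x = y \<xi> \<and> v = U \<xi>,
      distr (density lborel (\<lambda>\<xi>. ennreal (weak_deriv V \<xi>))) borel y))"

definition T_map :: "real \<Rightarrow> eulerian \<Rightarrow> eulerian" where
  "T_map t = M_map \<circ> S_map t \<circ> L_map"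

text \<open>\<open>grid_D h f j\<close> is the difference quotient of \<open>f\<close> over \<open>[2jh, (2j+2)h]\<close>.\<close>

definition grid_D :: "real \<Rightarrow> (real \<Rightarrow> real) \<Rightarrow> int \<Rightarrow> real" where
  "grid_D h f j = (f (of_int (2*j+2) * h) - f (of_int (2*j) * h)) / (2 * h)"

definition grid_q :: "real \<Rightarrow> (real \<Rightarrow> real) \<Rightarrow> (real \<Rightarrow> real) \<Rightarrow> int \<Rightarrow> real" where
  "grid_q h u Fac j = sqrt (grid_D h Fac j - (grid_D h u j)\<^sup>2)"

text \<open>For \<open>h > 0\<close> this is the unique \<open>j\<close> with \<open>2jh < x \<le> (2j+2)h\<close>.\<close>

definition cell :: "real \<Rightarrow> real \<Rightarrow> int" where
  "cell h x = \<lceil>x / (2 * h)\<rceil> - 1"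

text \<open>
  The sign choice in cell \<open>j\<close> is \<open>s j\<close>: the value \<open>1\<close> selects the upper and \<open>-1\<close> the lower
  signs, so that \<open>\<plusminus>\<close> becomes \<open>s j\<close> and \<open>\<mp>\<close> becomes \<open>- s j\<close>.
\<close>

definition proj_u :: "real \<Rightarrow> (int \<Rightarrow> real) \<Rightarrow> (real \<Rightarrow> real) \<Rightarrow> (real \<Rightarrow> real) \<Rightarrow> real \<Rightarrow> real" where
  "proj_u h s u Fac x =
     (let j = cell h x; x0 = of_int (2*j) * h; x1 = of_int (2*j+1) * h; x2 = of_int (2*j+2) * h;
          Du = grid_D h u j; q = grid_q h u Fac j
      in if x \<le> x1 then u x0 + (Du - s j * q) * (x - x0)
         else u x2 + (Du + s j * q) * (x - x2))"

definition proj_Fac :: "real \<Rightarrow> (int \<Rightarrow> real) \<Rightarrow> (real \<Rightarrow> real) \<Rightarrow> (real \<Rightarrow> real) \<Rightarrow> real \<Rightarrow> real" where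
  "proj_Fac h s u Fac x =
     (let j = cell h x; x0 = of_int (2*j) * h; x1 = of_int (2*j+1) * h; x2 = of_int (2*j+2) * h;
          Du = grid_D h u j; q = grid_q h u Fac j
      in if x \<le> x1 then Fac x0 + (Du - s j * q)\<^sup>2 * (x - x0)
         else 1/2 * (Fac x2 + Fac x0) - s j * 2 * q * Du * h + (Du + s j * q)\<^sup>2 * (x - x1))"

definition proj_Fsing :: "real \<Rightarrow> (real \<Rightarrow> real) \<Rightarrow> real \<Rightarrow> real" where
  "proj_Fsing h Fsing x = Fsing (of_int (2 * cell h x + 2) * h)"

definition P_map :: "real \<Rightarrow> (int \<Rightarrow> real) \<Rightarrow> eulerian \<Rightarrow> eulerian" where
  "P_map h s = (\<lambda>(u, \<mu>).
     let Fac = dist_fun (ac_part \<mu>); Fsing = dist_fun (sing_part \<mu>)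
     in (proj_u h s u Fac,
         measure_of_dist_fun (\<lambda>x. proj_Fac h s u Fac x + proj_Fsing h Fsing x)))"

end

theory Submission
  imports Defs "HOL-Probability.Distribution_Functions"
begin

text \<open>
  Let \<open>F\<close> be the distribution function of \<open>\<mu>\<close>, \<open>m\<close> its total mass and \<open>X \<theta> = sup {x. F x < \<theta>}\<close> its
  quantile function on \<open>(0, m)\<close>. The labels \<open>\<xi> = X \<theta> + \<theta>\<close> satisfy \<open>y \<xi> = X \<theta>\<close> and \<open>V \<xi> = \<theta>\<close>,
  and transport Lebesgue measure on \<open>(0, m)\<close> to \<open>V\<^sub>\<xi> d\<xi>\<close>. Since \<open>V\<close> does not change in time, \<open>\<mu>(t)\<close> is the
  image of Lebesgue measure on \<open>(0, m)\<close> under \<open>X \<theta> + t u(X \<theta>) + t\<^sup>2/4 (\<theta> - m/2)\<close>.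
  The projection keeps \<open>F\<close> and \<open>u\<close> at the even grid points, hence also \<open>m\<close>, so that for each \<open>\<theta>\<close> both
  quantiles lie in the same cell, of length \<open>2 \<Delta>x\<close>. There they differ by at most \<open>2 \<Delta>x\<close>, and by Cauchy--Schwarz
  the velocities differ by at most \<open>(1 + \<surd>2) \<surd>(m \<Delta>x)\<close>; the \<open>t\<^sup>2\<close> terms cancel. Integrating over \<open>\<theta>\<close> bounds
  the distance by \<open>(1 + \<surd>2) t m\<close> times \<open>\<surd>(m \<Delta>x)\<close>, plus \<open>2 m \<Delta>x\<close>.

  The cutoff \<open>\<chi>\<^sup>+\<close> itself provides the test functions \<open>\<chi>\<^sup>+(n (x - a)) - \<chi>\<^sup>+(n (x - b))\<close>, which identify the
  increments of a continuous function with the integrals of its weak derivative.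
\<close>

section \<open>Weak derivatives\<close>

lemma smooth_has_deriv: "smooth f \<Longrightarrow> (f has_real_derivative deriv f x) (at x)"
  unfolding smooth_def by (metis DERIV_deriv_iff_real_differentiable funpow_0)

lemma smooth_continuous: "smooth f \<Longrightarrow> continuous_on A f"
  by (meson DERIV_continuous continuous_at_imp_continuous_on smooth_has_deriv)

lemma smooth_continuous_deriv:
  assumes "smooth f"
  shows "continuous_on A (deriv f)"
proof -
  have "(deriv ^^ 1) f differentiable (at x)" for x
    using assms unfolding smooth_def by blast
  then show ?thesis
    by (metis One_nat_def continuous_at_imp_continuous_on differentiable_imp_continuous_within
        funpow_0 funpow_simps_right(2) o_apply)
qed

lemma smooth_deriv_n:
  "smooth f \<Longrightarrow> ((deriv ^^ n) f has_real_derivative (deriv ^^ Suc n) f x) (at x)"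
  unfolding smooth_def by (simp add: DERIV_deriv_iff_real_differentiable)

text \<open>Smoothness is defined through the iterates of \<open>deriv\<close>, so closure under a
  change of variable requires every iterate explicitly; the chain rule gives it by
  induction.\<close>

lemma deriv_n_affine:
  assumes "smooth f"
  shows "(deriv ^^ n) (\<lambda>x. f (c * (x - d))) = (\<lambda>x. c ^ n * (deriv ^^ n) f (c * (x - d)))"
proof (induction n)
  case (Suc n)
  have "((\<lambda>x. c ^ n * (deriv ^^ n) f (c * (x - d))) has_real_derivative
      c ^ Suc n * (deriv ^^ Suc n) f (c * (x - d))) (at x)" for x
    by (rule derivative_eq_intros DERIV_chain2[OF smooth_deriv_n[OF assms]] refl | simp)+
  then show ?case
    using Suc by (auto intro!: ext DERIV_imp_deriv)
qed simp

lemma deriv_n_diff: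
  assumes "smooth f" "smooth g"
  shows "(deriv ^^ n) (\<lambda>x. f x - g x) = (\<lambda>x. (deriv ^^ n) f x - (deriv ^^ n) g x)"
proof (induction n)
  case (Suc n)
  have "((\<lambda>x. (deriv ^^ n) f x - (deriv ^^ n) g x) has_real_derivative
      (deriv ^^ Suc n) f x - (deriv ^^ Suc n) g x) (at x)" for x
    by (intro DERIV_diff smooth_deriv_n assms)
  then show ?case
    using Suc by (auto intro!: ext DERIV_imp_deriv)
qed simp

lemma smooth_affine:
  assumes "smooth f"
  shows "smooth (\<lambda>x. f (c * (x - d)))"
  unfolding smooth_def
proof (intro allI)
  fix n x
  have "((\<lambda>x. c ^ n * (deriv ^^ n) f (c * (x - d))) has_real_derivative
      c ^ Suc n * (deriv ^^ Suc n) f (c * (x - d))) (at x)"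
    by (rule derivative_eq_intros DERIV_chain2[OF smooth_deriv_n[OF assms]] refl | simp)+
  then show "(deriv ^^ n) (\<lambda>x. f (c * (x - d))) differentiable (at x)"
    by (subst deriv_n_affine[OF assms]) (use real_differentiable_def in blast)
qed

lemma smooth_diff:
  assumes "smooth f" "smooth g"
  shows "smooth (\<lambda>x. f x - g x)"
  using assms unfolding smooth_def
  by (simp add: deriv_n_diff[OF assms] differentiable_diff)

text \<open>The values 0 and 1 outside (-1, 1) come from the supports: \<open>\<chi>p\<close>
  vanishes left of its support, and right of 1 the partner \<open>\<chi>m\<close> vanishes, so the
  sum condition forces \<open>\<chi>p\<close> to be 1.\<close>

lemma cutoff_pairD:
  assumes "cutoff_pair \<chi>p \<chi>m"
  shows "smooth \<chi>p" "smooth \<chi>m" "\<bar>\<chi>p x\<bar> \<le> 1"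
    "x \<le> -1 \<Longrightarrow> \<chi>p x = 0" "1 \<le> x \<Longrightarrow> \<chi>p x = 1" "\<chi>m x = 1 - \<chi>p x"
proof -
  have *: "f x \<noteq> 0 \<Longrightarrow> x \<in> supp f" for f :: "real \<Rightarrow> real"
    unfolding supp_def by (simp add: closure_def)
  show "smooth \<chi>p" "smooth \<chi>m" using assms by (auto simp: cutoff_pair_def)
  have "0 \<le> \<chi>p x \<and> \<chi>p x \<le> 1" "\<chi>p x + \<chi>m x = 1" using assms by (auto simp: cutoff_pair_def)
  then show "\<bar>\<chi>p x\<bar> \<le> 1" "\<chi>m x = 1 - \<chi>p x" by auto
  have "supp \<chi>p \<subseteq> {-1<..}" "supp \<chi>m \<subseteq> {..<1}" using assms by (auto simp: cutoff_pair_def)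
  then show "x \<le> -1 \<Longrightarrow> \<chi>p x = 0" "1 \<le> x \<Longrightarrow> \<chi>p x = 1"
    using *[of \<chi>p] *[of \<chi>m] \<open>\<chi>p x + \<chi>m x = 1\<close> by (meson greaterThan_iff not_le subsetD, fastforce)
qed

lemma deriv_cutoff_eq_0:
  assumes "cutoff_pair \<chi>p \<chi>m" "x \<notin> {-1..1}"
  shows "deriv \<chi>p x = 0"
proof -
  note C = cutoff_pairD[OF assms(1)]
  have "x < -1 \<or> 1 < x" using assms(2) by auto
  then show ?thesis
  proof
    assume "x < -1"
    have "(\<chi>p has_real_derivative 0) (at x)"
      by (rule has_field_derivative_transform_within_open[of "\<lambda>_. 0" _ _ "{..<-1}"])
        (use \<open>x < -1\<close> C in auto)
    then show ?thesis by (rule DERIV_imp_deriv)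
  next
    assume "1 < x"
    have "(\<chi>p has_real_derivative 0) (at x)"
      by (rule has_field_derivative_transform_within_open[of "\<lambda>_. 1" _ _ "{1<..}"])
        (use \<open>1 < x\<close> C in auto)
    then show ?thesis by (rule DERIV_imp_deriv)
  qed
qed

lemma integrable_continuous_compact_support:
  fixes h :: "real \<Rightarrow> real"
  assumes "continuous_on UNIV h" "\<And>x. x \<notin> {a..b} \<Longrightarrow> h x = 0"
  shows "integrable lborel h"
proof -
  have "integrable lborel (\<lambda>x. indicator {a..b} x *\<^sub>R h x)"
    by (rule borel_integrable_compact) (auto intro: continuous_on_subset[OF assms(1)])
  also have "(\<lambda>x. indicator {a..b} x *\<^sub>R h x) = h"
    using assms(2) by (auto simp: indicator_def fun_eq_iff)
  finally show ?thesis .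
qed

text \<open>This normalisation turns the derivative of the cutoff into a mollifying kernel with
  support in [-1, 1].\<close>

lemma integral_deriv_cutoff:
  assumes "cutoff_pair \<chi>p \<chi>m"
  shows "(LINT x|lborel. deriv \<chi>p x) = 1"
proof -
  note C = cutoff_pairD[OF assms]
  have "(LINT x|lborel. deriv \<chi>p x) = (LINT x|lborel. indicator {-1..1} x *\<^sub>R deriv \<chi>p x)"
    by (rule Bochner_Integration.integral_cong)
      (use deriv_cutoff_eq_0[OF assms] in \<open>auto simp: indicator_def\<close>)
  also have "\<dots> = \<chi>p 1 - \<chi>p (-1)"
    by (rule integral_FTC_atLeastAtMost)
      (auto simp: has_real_derivative_iff_has_vector_derivative[symmetric]
        intro!: DERIV_subset[OF smooth_has_deriv[OF C(1)]] smooth_continuous_deriv[OF C(1)])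
  finally show ?thesis using C by simp
qed

text \<open>The substitution \<open>x = a + z / (n + 1)\<close> moves the scaling from the kernel to
  \<open>f\<close>. As the kernel lives on [-1, 1], only values of \<open>f\<close> on [a-1, a+1]
  enter, and their bound \<open>B\<close> gives the dominating function.\<close>

lemma mollifier_tendsto:
  fixes f :: "real \<Rightarrow> real"
  assumes cut: "cutoff_pair \<chi>p \<chi>m" and f: "continuous_on UNIV f"
  shows "(\<lambda>n. LINT x|lborel. f x * (real (Suc n) * deriv \<chi>p (real (Suc n) * (x - a)))) \<longlonglongrightarrow> f a"
proof -
  note C = cutoff_pairD[OF cut]
  let ?d = "deriv \<chi>p"
  have df: "continuous_on UNIV ?d" by (rule smooth_continuous_deriv[OF C(1)])
  have [measurable]: "f \<in> borel_measurable borel" "?d \<in> borel_measurable borel"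
    using f df by (auto intro: borel_measurable_continuous_onI)
  have eq: "(LINT x|lborel. f x * (real (Suc n) * ?d (real (Suc n) * (x - a))))
      = (LINT z|lborel. f (a + (1 / real (Suc n)) * z) * ?d z)" for n
    by (subst lborel_integral_real_affine[of "1 / real (Suc n)" _ a])
      (simp_all flip: Bochner_Integration.integral_mult_right_zero del: of_nat_Suc
        add: field_simps)
  have "compact (f ` {a-1..a+1})"
    by (intro compact_continuous_image continuous_on_subset[OF f]) auto
  then obtain B where B: "\<And>x. x \<in> {a-1..a+1} \<Longrightarrow> \<bar>f x\<bar> \<le> B"
    by (metis (no_types, lifting) bounded_iff compact_imp_bounded imageI real_norm_def)
  have "(\<lambda>n. LINT z|lborel. f (a + (1 / real (Suc n)) * z) * ?d z) \<longlonglongrightarrow> (LINT z|lborel. f a * ?d z)"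
  proof (rule integral_dominated_convergence[where w="\<lambda>z. B * \<bar>?d z\<bar>"])
    have "integrable lborel ?d"
      by (rule integrable_continuous_compact_support[OF df deriv_cutoff_eq_0[OF cut]])
    then show "integrable lborel (\<lambda>z. B * \<bar>?d z\<bar>)" by auto
    show "AE z in lborel. (\<lambda>n. f (a + (1 / real (Suc n)) * z) * ?d z) \<longlonglongrightarrow> f a * ?d z"
    proof (rule AE_I2)
      fix z
      have l: "(\<lambda>n. a + (1 / real (Suc n)) * z) \<longlonglongrightarrow> a + 0 * z"
        by (intro tendsto_intros) (metis LIMSEQ_inverse_real_of_nat inverse_eq_divide[abs_def])
      have "isCont f a" using f by (simp add: continuous_on_eq_continuous_at)
      then have "(\<lambda>n. f (a + (1 / real (Suc n)) * z)) \<longlonglongrightarrow> f a"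
        using isCont_tendsto_compose[of a f] l by simp
      then show "(\<lambda>n. f (a + (1 / real (Suc n)) * z) * ?d z) \<longlonglongrightarrow> f a * ?d z"
        by (intro tendsto_intros)
    qed
    show "AE z in lborel. norm (f (a + (1 / real (Suc n)) * z) * ?d z) \<le> B * \<bar>?d z\<bar>" for n
    proof (rule AE_I2)
      fix z
      show "norm (f (a + (1 / real (Suc n)) * z) * ?d z) \<le> B * \<bar>?d z\<bar>"
      proof (cases "z \<in> {-1..1}")
        case True
        then have "\<bar>z\<bar> \<le> 1" by auto
        then have "\<bar>(1 / real (Suc n)) * z\<bar> \<le> 1"
          by (auto simp: abs_mult divide_simps)
        then have "\<bar>f (a + (1 / real (Suc n)) * z)\<bar> \<le> B"
          by (intro B) (simp only: abs_le_iff atLeastAtMost_iff, linarith)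
        then show ?thesis by (simp add: abs_mult mult_right_mono)
      qed (simp add: deriv_cutoff_eq_0[OF cut])
    qed
  qed measurable
  then show ?thesis
    unfolding eq using integral_deriv_cutoff[OF cut] by simp
qed

text \<open>These are smoothed indicators of [a, b]. Left of a-1 both arguments are at most -1,
  right of b+1 both are at least 1; the condition on \<open>c\<close> keeps the rescaling from
  widening the transition zones.\<close>

lemma test_function_bump:
  assumes cut: "cutoff_pair \<chi>p \<chi>m" and "a \<le> b" "1 \<le> c"
  shows "test_function (\<lambda>x. \<chi>p (c * (x - a)) - \<chi>p (c * (x - b)))"
    and "x \<notin> {a-1..b+1} \<Longrightarrow> \<chi>p (c * (x - a)) - \<chi>p (c * (x - b)) = 0"
proof -
  note C = cutoff_pairD[OF cut]
  show *: "\<chi>p (c * (x - a)) - \<chi>p (c * (x - b)) = 0" if out: "x \<notin> {a-1..b+1}" for x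
  proof -
    consider "x \<le> a - 1" | "x \<ge> b + 1" using out by (metis atLeastAtMost_iff linear)
    then show ?thesis
    proof cases
      case 1
      have "c * (x - a) \<le> 1 * (x - a)" "c * (x - b) \<le> 1 * (x - b)"
        using 1 assms by (auto intro!: mult_right_mono_neg)
      moreover have "x - a \<le> -1" "x - b \<le> -1" using 1 assms by auto
      ultimately have "c * (x - a) \<le> -1" "c * (x - b) \<le> -1" by (metis mult_1 order_trans)+
      then show ?thesis using C(4) by simp
    next
      case 2
      have "c * (x - a) \<ge> 1 * (x - a)" "c * (x - b) \<ge> 1 * (x - b)"
        using 2 assms by (auto intro!: mult_right_mono)
      moreover have "1 \<le> x - a" "1 \<le> x - b" using 2 assms by auto
      ultimately have "1 \<le> c * (x - a)" "1 \<le> c * (x - b)" by (metis mult_1 order_trans)+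
      then show ?thesis using C(5) by simp
    qed
  qed
  have "supp (\<lambda>x. \<chi>p (c * (x - a)) - \<chi>p (c * (x - b))) \<subseteq> {a-1..b+1}"
    unfolding supp_def by (rule closure_minimal) (use * in \<open>blast, simp\<close>)
  then have "compact (supp (\<lambda>x. \<chi>p (c * (x - a)) - \<chi>p (c * (x - b))))"
    by (metis (no_types, lifting) bounded_closed_interval bounded_subset closed_closure
        compact_eq_bounded_closed supp_def)
  then show "test_function (\<lambda>x. \<chi>p (c * (x - a)) - \<chi>p (c * (x - b)))"
    unfolding test_function_def by (intro conjI smooth_diff smooth_affine C(1))
qed

text \<open>Testing the weak derivative against the bumps \<open>\<phi> n\<close> gives two limits:
  the derivatives of the bumps concentrate at the endpoints and yield \<open>f a - f b\<close>,
  while the bumps themselves converge to the indicator of [a, b].\<close>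

lemma weak_deriv_integral_Icc:
  assumes cut: "cutoff_pair \<chi>p \<chi>m" and w: "has_weak_deriv f g"
    and f: "continuous_on UNIV f" and "a \<le> b"
  shows "(LINT x:{a..b}|lborel. g x) = f b - f a"
proof (cases "a = b")
  case True
  have "AE x in lborel. indicator {a..b} x *\<^sub>R g x = 0"
    using AE_lborel_singleton[of a] by eventually_elim (use True in auto)
  then show ?thesis
    using True by (simp add: set_lebesgue_integral_def integral_eq_zero_AE)
next
  case False
  note C = cutoff_pairD[OF cut]
  let ?d = "deriv \<chi>p"
  define \<phi> where "\<phi> n x = \<chi>p (real (Suc n) * (x - a)) - \<chi>p (real (Suc n) * (x - b))" for n x
  have dphi: "deriv (\<phi> n) x = real (Suc n) * ?d (real (Suc n) * (x - a)) - real (Suc n) * ?d (real (Suc n) * (x - b))"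
    for n x
  proof -
    have "(\<phi> n has_real_derivative ?d (real (Suc n) * (x - a)) * (real (Suc n) * (1 - 0)) - ?d (real (Suc n) * (x - b)) * (real (Suc n) * (1 - 0))) (at x)"
      unfolding \<phi>_def
      by (intro DERIV_diff DERIV_chain2[OF smooth_has_deriv[OF C(1)]] DERIV_cmult DERIV_ident DERIV_const)
    then show ?thesis by (simp add: DERIV_imp_deriv mult.commute)
  qed
  have int: "integrable lborel (\<lambda>x. f x * (real (Suc n) * ?d (real (Suc n) * (x - c))))" for n c
  proof (rule integrable_continuous_compact_support)
    show "continuous_on UNIV (\<lambda>x. f x * (real (Suc n) * ?d (real (Suc n) * (x - c))))"
      by (intro continuous_intros f continuous_on_compose2[OF smooth_continuous_deriv[OF C(1), of UNIV]]) auto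
    show "f x * (real (Suc n) * ?d (real (Suc n) * (x - c))) = 0" if "x \<notin> {c - 1..c + 1}" for x
    proof -
      have "\<bar>x - c\<bar> > 1" using that by auto
      then have "1 < real (Suc n) * \<bar>x - c\<bar>"
        using less_le_trans[of 1 "\<bar>x - c\<bar>" "real (Suc n) * \<bar>x - c\<bar>"]
          mult_right_mono[of 1 "real (Suc n)" "\<bar>x - c\<bar>"] by simp
      then have "1 < \<bar>real (Suc n) * (x - c)\<bar>" by (simp add: abs_mult)
      then have "real (Suc n) * (x - c) \<notin> {-1..1}" by (simp only: atLeastAtMost_iff) linarith
      then show ?thesis using deriv_cutoff_eq_0[OF cut] by simp
    qed
  qed
  have lg: "set_integrable lborel {a-1..b+1} g"
    using w unfolding has_weak_deriv_def locally_integrable_def by blast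
  have tf: "test_function (\<phi> n)" for n
    unfolding \<phi>_def by (rule test_function_bump(1)[OF cut \<open>a \<le> b\<close>]) simp
  have sm: "continuous_on UNIV (\<phi> n)" for n
    using tf unfolding test_function_def by (auto intro: smooth_continuous)
  have zero: "\<phi> n x = 0" if "x \<notin> {a-1..b+1}" for n x
    using test_function_bump(2)[OF cut \<open>a \<le> b\<close> _ that, of "real (Suc n)"] by (simp add: \<phi>_def)
  have bnd: "\<bar>\<phi> n x\<bar> \<le> 2" for n x
    unfolding \<phi>_def using C(3)[of "real (Suc n) * (x - a)"] C(3)[of "real (Suc n) * (x - b)"] by linarith
  \<comment> \<open>The endpoints are excluded because there the limit involves the unspecified
    value \<open>\<chi>p 0\<close>; they form a null set.\<close>
  have lim: "(\<lambda>n. \<phi> n x) \<longlonglongrightarrow> indicator {a..b} x" if "x \<noteq> a" "x \<noteq> b" for x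
  proof -
    have step: "(\<lambda>n. \<chi>p (real (Suc n) * (x - c))) \<longlonglongrightarrow> (if c < x then 1 else 0)" if "x \<noteq> c" for c
    proof -
      obtain N where N: "1 < real N * \<bar>x - c\<bar>"
        using reals_Archimedean3[of "\<bar>x - c\<bar>"] \<open>x \<noteq> c\<close> by auto
      have "\<forall>\<^sub>F n in sequentially. \<chi>p (real (Suc n) * (x - c)) = (if c < x then 1 else 0)"
        using eventually_ge_at_top[of N]
      proof eventually_elim
        case (elim n)
        have "real N * \<bar>x - c\<bar> \<le> real (Suc n) * \<bar>x - c\<bar>"
          using elim by (intro mult_right_mono) auto
        then have "1 < \<bar>real (Suc n) * (x - c)\<bar>" using N by (simp add: abs_mult)
        moreover have "real (Suc n) * (x - c) > 0 \<longleftrightarrow> c < x" 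
          by (simp add: zero_less_mult_iff)
        ultimately show ?case using C(4)[of "real (Suc n) * (x - c)"] C(5)[of "real (Suc n) * (x - c)"]
          by (auto simp del: of_nat_Suc)
      qed
      then show ?thesis by (simp add: tendsto_eventually)
    qed
    have "(\<lambda>n. \<phi> n x) \<longlonglongrightarrow> (if a < x then 1 else 0) - (if b < x then 1 else 0)"
      unfolding \<phi>_def by (intro tendsto_diff step that)
    also have "(if a < x then 1 else 0) - (if b < x then 1 else 0) = (indicator {a..b} x :: real)"
      using that \<open>a \<le> b\<close> by (auto simp: indicator_def)
    finally show ?thesis .
  qed
  have 1: "(\<lambda>n. LINT x|lborel. f x * deriv (\<phi> n) x) \<longlonglongrightarrow> f a - f b"
  proof -
    have "(LINT x|lborel. f x * deriv (\<phi> n) x)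
       = (LINT x|lborel. f x * (real (Suc n) * ?d (real (Suc n) * (x - a)))) - (LINT x|lborel. f x * (real (Suc n) * ?d (real (Suc n) * (x - b))))" for n
      unfolding dphi right_diff_distrib[of "f _"]
      by (rule Bochner_Integration.integral_diff[OF int int])
    then show ?thesis
      using tendsto_diff[OF mollifier_tendsto[OF cut f] mollifier_tendsto[OF cut f]] by presburger
  qed
  \<comment> \<open>Truncating \<open>g\<close> to [a-1, b+1] leaves the product with
    \<open>\<phi> n\<close> unchanged and makes a multiple of the truncated function an integrable
    bound, although \<open>g\<close> is only locally integrable.\<close>
  have 2: "(\<lambda>n. LINT x|lborel. (indicator {a-1..b+1} x *\<^sub>R g x) * \<phi> n x)
     \<longlonglongrightarrow> (LINT x|lborel. indicator {a..b} x *\<^sub>R g x)"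
  proof (rule integral_dominated_convergence[where w="\<lambda>x. 2 * \<bar>indicator {a-1..b+1} x *\<^sub>R g x\<bar>"])
    have [measurable]: "(\<lambda>x. indicator {a-1..b+1} x *\<^sub>R g x) \<in> borel_measurable lborel"
      using lg unfolding set_integrable_def by (rule borel_measurable_integrable)
    have [measurable]: "\<phi> n \<in> borel_measurable lborel" for n
      using borel_measurable_continuous_onI[OF sm] by simp
    show "(\<lambda>x. indicator {a-1..b+1} x *\<^sub>R g x * \<phi> n x) \<in> borel_measurable lborel" for n
      by measurable
    have "(\<lambda>x. indicator {a..b} x *\<^sub>R g x) = (\<lambda>x. indicator {a..b} x *\<^sub>R (indicator {a-1..b+1} x *\<^sub>R g x))"
      by (auto simp: indicator_def)
    also have "\<dots> \<in> borel_measurable lborel" by measurable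
    finally show "(\<lambda>x. indicator {a..b} x *\<^sub>R g x) \<in> borel_measurable lborel" .
    show "integrable lborel (\<lambda>x. 2 * \<bar>indicator {a-1..b+1} x *\<^sub>R g x\<bar>)"
      using lg unfolding set_integrable_def by auto
    show "AE x in lborel. norm (indicator {a-1..b+1} x *\<^sub>R g x * \<phi> n x)
        \<le> 2 * \<bar>indicator {a-1..b+1} x *\<^sub>R g x\<bar>" for n
    proof (rule AE_I2)
      fix x
      show "norm (indicator {a-1..b+1} x *\<^sub>R g x * \<phi> n x) \<le> 2 * \<bar>indicator {a-1..b+1} x *\<^sub>R g x\<bar>"
        using mult_left_mono[OF bnd abs_ge_zero, of "indicator {a-1..b+1} x *\<^sub>R g x" n x]
        by (simp only: abs_mult real_norm_def mult.commute[of 2])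
    qed
    have "AE x in lborel. x \<noteq> a \<and> x \<noteq> b"
      using AE_lborel_singleton[of a] AE_lborel_singleton[of b] by simp
    then show "AE x in lborel. (\<lambda>n. indicator {a-1..b+1} x *\<^sub>R g x * \<phi> n x) \<longlonglongrightarrow> indicator {a..b} x *\<^sub>R g x"
    proof eventually_elim
      case (elim x)
      have "(\<lambda>n. indicator {a-1..b+1} x *\<^sub>R g x * \<phi> n x) \<longlonglongrightarrow> indicator {a-1..b+1} x *\<^sub>R g x * indicator {a..b} x"
        by (intro tendsto_mult tendsto_const lim) (use elim in auto)
      also have "indicator {a-1..b+1} x *\<^sub>R g x * indicator {a..b} x = indicator {a..b} x *\<^sub>R g x"
        by (auto simp: indicator_def)
      finally show ?case .
    qed
  qed
  have "(LINT x|lborel. f x * deriv (\<phi> n) x) = - (LINT x|lborel. (indicator {a-1..b+1} x *\<^sub>R g x) * \<phi> n x)" for n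
  proof -
    have "(LINT x|lborel. f x * deriv (\<phi> n) x) = - (LINT x|lborel. g x * \<phi> n x)"
      using w tf unfolding has_weak_deriv_def by blast
    also have "(LINT x|lborel. g x * \<phi> n x) = (LINT x|lborel. (indicator {a-1..b+1} x *\<^sub>R g x) * \<phi> n x)"
      by (rule Bochner_Integration.integral_cong) (use zero in \<open>auto simp: indicator_def\<close>)
    finally show ?thesis .
  qed
  then have "(\<lambda>n. LINT x|lborel. f x * deriv (\<phi> n) x) \<longlonglongrightarrow> - (LINT x|lborel. indicator {a..b} x *\<^sub>R g x)"
    using tendsto_minus[OF 2] by presburger
  from LIMSEQ_unique[OF 1 this] show ?thesis
    unfolding set_lebesgue_integral_def by linarith
qed

section \<open>From integrals back to weak derivatives, and uniqueness almost everywhere\<close>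

lemma has_weak_deriv_weak_deriv: "has_weak_deriv f g \<Longrightarrow> has_weak_deriv f (weak_deriv f)"
  unfolding weak_deriv_def by (rule someI[where P="has_weak_deriv f"])

lemma locally_integrable_measurable:
  assumes "locally_integrable f"
  shows "f \<in> borel_measurable borel"
proof (rule borel_measurable_LIMSEQ_real)
  show "(\<lambda>n. indicator {-real n..real n} x * f x) \<longlonglongrightarrow> f x" for x
  proof (rule tendsto_eventually)
    obtain n where n: "\<bar>x\<bar> \<le> real n" using real_arch_simple by blast
    then show "\<forall>\<^sub>F n in sequentially. indicator {-real n..real n} x * f x = f x"
      by (intro eventually_sequentiallyI[of n]) (auto simp: indicator_def)
  qed
  show "(\<lambda>x. indicator {-real n..real n} x * f x) \<in> borel_measurable borel" for n
  proof -
    have "integrable lborel (\<lambda>x. indicator {-real n..real n} x *\<^sub>R f x)"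
      using assms unfolding locally_integrable_def set_integrable_def by blast
    from borel_measurable_integrable[OF this] show ?thesis by simp
  qed
qed

lemma locally_integrable_continuous:
  assumes "continuous_on UNIV f"
  shows "locally_integrable f"
  unfolding locally_integrable_def set_integrable_def
  by (intro allI borel_integrable_compact continuous_on_subset[OF assms]) auto

text \<open>Integration by parts through Fubini: with \<open>f x\<close> written as
  \<open>f (-R)\<close> plus the integral of \<open>g\<close> from -R to x, exchanging the order
  over the triangle \<open>z \<le> x\<close> leaves the integral of the derivative of
  \<open>\<phi>\<close> over [z, R], which is \<open>- \<phi> z\<close>.\<close>

lemma has_weak_deriv_if_integral:
  assumes f: "continuous_on UNIV f" and g: "locally_integrable g"
    and eq: "\<And>a b. a \<le> b \<Longrightarrow> f b - f a = (LINT x:{a..b}|lborel. g x)"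
  shows "has_weak_deriv f g"
  unfolding has_weak_deriv_def
proof (intro conjI allI impI g locally_integrable_continuous[OF f])
  fix \<phi> assume phi: "test_function \<phi>"
  then have sm: "smooth \<phi>" and "compact (supp \<phi>)" by (auto simp: test_function_def)
  from \<open>compact (supp \<phi>)\<close> obtain R0 where R0: "\<And>x. x \<in> supp \<phi> \<Longrightarrow> \<bar>x\<bar> \<le> R0"
    by (metis bounded_iff compact_imp_bounded real_norm_def)
  \<comment> \<open>The margin makes R positive and lets \<open>\<phi>\<close> vanish at -R and R
    themselves, so no boundary terms remain.\<close>
  define R where "R = \<bar>R0\<bar> + 1"
  have "R > 0" "R > R0" by (auto simp: R_def)
  have nz: "\<phi> x \<noteq> 0 \<Longrightarrow> x \<in> supp \<phi>" for x by (simp add: supp_def closure_def)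
  have z: "\<phi> x = 0" if "\<bar>x\<bar> \<ge> R" for x
    using nz R0 that \<open>R > R0\<close> by fastforce
  have dz: "deriv \<phi> x = 0" if "x \<notin> {-R..R}" for x
  proof -
    have "(\<phi> has_real_derivative 0) (at x)"
      by (rule has_field_derivative_transform_within_open[of "\<lambda>_. 0" _ _ "-{-R..R}"])
        (use that z in \<open>auto simp: open_Compl\<close>)
    then show ?thesis by (rule DERIV_imp_deriv)
  qed
  let ?d = "deriv \<phi>"
  have cd: "continuous_on A ?d" for A by (rule smooth_continuous_deriv[OF sm])
  have ftc: "(LINT x:{c..R}|lborel. ?d x) = - \<phi> c" if "c \<le> R" for c
  proof -
    have "(LINT x:{c..R}|lborel. ?d x) = \<phi> R - \<phi> c"
      unfolding set_lebesgue_integral_def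
      by (rule integral_FTC_atLeastAtMost)
        (auto simp: has_real_derivative_iff_has_vector_derivative[symmetric] that
          intro!: DERIV_subset[OF smooth_has_deriv[OF sm]] cd)
    then show ?thesis using z[of R] \<open>R > 0\<close> by simp
  qed
  define G where "G = (\<lambda>x. indicator {-R..R} x * g x)"
  define D where "D = (\<lambda>x. indicator {-R..R} x * ?d x)"
  have Gi: "integrable lborel G" using g unfolding G_def locally_integrable_def set_integrable_def by simp
  have D_eq: "D = ?d" using dz by (force simp: D_def indicator_def fun_eq_iff)
  have Di: "integrable lborel D" unfolding D_eq
    by (rule integrable_continuous_compact_support[OF cd dz])
  have [measurable]: "G \<in> borel_measurable borel" "D \<in> borel_measurable borel"
    using Gi Di by (auto dest: borel_measurable_integrable)
  have prod: "integrable (lborel \<Otimes>\<^sub>M lborel) (\<lambda>(z, x). G z * D x)"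
    by (rule lborel_pair.Fubini_integrable) (use Gi Di in \<open>auto simp: abs_mult\<close>)
  \<comment> \<open>The product of the truncated functions is integrable on the plane and dominates
    its restriction \<open>K\<close> to the triangle, as Fubini requires.\<close>
  define K where "K z x = (if z \<le> x then G z * D x else 0)" for z x
  have int2: "integrable (lborel \<Otimes>\<^sub>M lborel) (case_prod K)"
    unfolding K_def by (rule Bochner_Integration.integrable_bound[OF prod]) (auto simp: split_beta')
  have "(LINT x|lborel. f x * ?d x) = (LINT x|lborel. f (-R) * D x + (LINT z|lborel. K z x))"
  proof (rule Bochner_Integration.integral_cong)
    fix x
    show "f x * ?d x = f (-R) * D x + (LINT z|lborel. K z x)"
    proof (cases "x \<in> {-R..R}")
      case True
      then have "f x = f (-R) + (LINT z:{-R..x}|lborel. g z)" using eq[of "-R" x] by simp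
      also have "(LINT z:{-R..x}|lborel. g z) = (LINT z|lborel. (if z \<le> x then G z else 0))"
        unfolding set_lebesgue_integral_def
        by (rule Bochner_Integration.integral_cong) (use True in \<open>auto simp: G_def indicator_def\<close>)
      finally have "f x * ?d x = f (-R) * D x + (LINT z|lborel. (if z \<le> x then G z else 0)) * D x"
        by (simp add: D_eq distrib_right)
      also have "(LINT z|lborel. (if z \<le> x then G z else 0)) * D x = (LINT z|lborel. (if z \<le> x then G z else 0) * D x)"
        by simp
      also have "\<dots> = (LINT z|lborel. K z x)"
        by (rule Bochner_Integration.integral_cong) (auto simp: K_def)
      finally show ?thesis .
    next
      case False
      then have "D x = 0" "?d x = 0" using dz by (auto simp: D_def)
      then show ?thesis by (simp add: K_def cong: if_cong)
    qed
  qed simp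
  also have "\<dots> = (LINT x|lborel. f (-R) * D x) + (LINT x|lborel. LINT z|lborel. K z x)"
    by (rule Bochner_Integration.integral_add) (use Di lborel_pair.integrable_snd[OF int2] in auto)
  also have "(LINT x|lborel. f (-R) * D x) = 0"
  proof -
    have "(LINT x|lborel. D x) = (LINT x:{-R..R}|lborel. ?d x)"
      by (simp add: D_def set_lebesgue_integral_def)
    also have "\<dots> = 0" using ftc[of "-R"] z[of "-R"] \<open>R > 0\<close> by simp
    finally show ?thesis by simp
  qed
  also have "(LINT x|lborel. LINT z|lborel. K z x)
      = (LINT z|lborel. LINT x|lborel. K z x)"
    by (rule lborel_pair.Fubini_integral[OF int2])
  also have "\<dots> = (LINT z|lborel. - (g z * \<phi> z))"
  proof (rule Bochner_Integration.integral_cong)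
    fix z
    show "(LINT x|lborel. K z x) = - (g z * \<phi> z)"
    proof (cases "z \<in> {-R..R}")
      case True
      have "(LINT x|lborel. K z x) = (LINT x|lborel. G z * (indicator {z..R} x * ?d x))"
        by (rule Bochner_Integration.integral_cong) (use True in \<open>auto simp: K_def D_def indicator_def\<close>)
      also have "\<dots> = G z * (LINT x:{z..R}|lborel. ?d x)"
        by (simp add: set_lebesgue_integral_def)
      also have "\<dots> = - (g z * \<phi> z)" using True ftc[of z] by (simp add: G_def)
      finally show ?thesis .
    next
      case False
      then have "\<phi> z = 0" by (intro z) auto
      then show ?thesis using False by (simp add: K_def G_def cong: if_cong)
    qed
  qed simp
  finally show "(LINT x|lborel. f x * ?d x) = - (LINT x|lborel. g x * \<phi> x)" by simp
qed

text \<open>On each [-n, n] the positive and the negative part of the difference are densities of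
  finite measures that agree on half-lines, hence are equal. The two parts are never positive
  together, so both vanish almost everywhere; countably many intervals cover the line.\<close>

lemma AE_eq_if_integral_Icc_eq:
  assumes f: "locally_integrable f" and g: "locally_integrable g"
    and eq: "\<And>a b. a \<le> b \<Longrightarrow> (LINT x:{a..b}|lborel. f x) = (LINT x:{a..b}|lborel. g x)"
  shows "AE x in lborel. f x = g x"
proof -
  have "AE x in lborel. x \<in> {-real n..real n} \<longrightarrow> f x = g x" for n :: nat
  proof -
    define I where "I = {-real n..real n}"
    define F where "F = (\<lambda>x. indicator I x * f x)"
    define G where "G = (\<lambda>x. indicator I x * g x)"
    have Fi: "integrable lborel F" and Gi: "integrable lborel G"
      using f g unfolding F_def G_def I_def locally_integrable_def set_integrable_def by auto
    define p where "p x = max 0 (F x - G x)" for x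
    define q where "q x = max 0 (G x - F x)" for x
    have pi: "integrable lborel p" and qi: "integrable lborel q"
      unfolding p_def q_def using Fi Gi by auto
    have [measurable]: "p \<in> borel_measurable borel" "q \<in> borel_measurable borel"
      using pi qi by (auto dest: borel_measurable_integrable)
    have pq: "p x + G x = q x + F x" for x by (auto simp: p_def q_def)
    have em: "emeasure (density lborel h) {x<..} = ennreal (LINT z:{x<..}|lborel. h z)"
      if "integrable lborel h" "\<And>x. 0 \<le> h x" for h :: "real \<Rightarrow> real" and x
    proof -
      have [measurable]: "h \<in> borel_measurable borel" using that by (auto dest: borel_measurable_integrable)
      have "emeasure (density lborel h) {x<..} = (\<integral>\<^sup>+z. ennreal (indicator {x<..} z * h z) \<partial>lborel)"
        by (subst emeasure_density) (auto intro!: nn_integral_cong simp: indicator_def)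
      also have "\<dots> = ennreal (LINT z|lborel. indicator {x<..} z * h z)"
        by (rule nn_integral_eq_integral)
          (use that integrable_mult_indicator[OF _ that(1), of "{x<..}"] in auto)
      finally show ?thesis by (simp add: set_lebesgue_integral_def)
    qed
    have "density lborel p = density lborel q"
    proof (rule measure_eqI_lessThan)
      fix x
      show "emeasure (density lborel p) {x<..} < \<infinity>"
        using em[OF pi, of x] by (simp add: p_def)
      have "(LINT z:{x<..}|lborel. F z) = (LINT z:{x<..}|lborel. G z)"
      proof -
        \<comment> \<open>The open half-line cuts \<open>I\<close> in an interval that differs from
          a closed one at most by the point x, so the hypothesis on closed intervals
          applies.\<close>
        have "(LINT z:{x<..}|lborel. indicator I z * h z) = (LINT z:{max x (-real n)..real n}|lborel. h z)"
          if "integrable lborel (\<lambda>z. indicator I z * h z)" for h :: "real \<Rightarrow> real"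
        proof -
          let ?J = "{max x (-real n)..real n}"
          have [measurable]: "(\<lambda>z. indicator I z * h z) \<in> borel_measurable lborel"
            using that by (rule borel_measurable_integrable)
          have "AE z in lborel. indicator {x<..} z *\<^sub>R (indicator I z * h z) = indicator ?J z *\<^sub>R (indicator I z * h z)"
            using AE_lborel_singleton[of x] by eventually_elim (auto simp: I_def indicator_def)
          then have "(LINT z:{x<..}|lborel. indicator I z * h z) = (LINT z:?J|lborel. indicator I z * h z)"
            unfolding set_lebesgue_integral_def by (intro integral_cong_AE) measurable
          also have "\<dots> = (LINT z:?J|lborel. h z)"
            unfolding set_lebesgue_integral_def
            by (rule Bochner_Integration.integral_cong) (auto simp: I_def indicator_def)
          finally show ?thesis .
        qed
        then show ?thesis using Fi Gi unfolding F_def G_def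
          using eq[of "max x (-real n)" "real n"]
          by (cases "max x (-real n) \<le> real n") (auto simp: set_lebesgue_integral_def)
      qed
      moreover have si: "set_integrable lborel {x<..} h" if "integrable lborel h" for h :: "real \<Rightarrow> real"
        using integrable_mult_indicator[OF _ that, of "{x<..}"] by (simp add: set_integrable_def)
      moreover have "(LINT z:{x<..}|lborel. p z + G z) = (LINT z:{x<..}|lborel. q z + F z)"
        by (simp add: pq)
      ultimately have "(LINT z:{x<..}|lborel. p z) = (LINT z:{x<..}|lborel. q z)"
        using pi qi Fi Gi by (simp add: set_integral_add)
      then show "emeasure (density lborel p) {x<..} = emeasure (density lborel q) {x<..}"
        using em[OF pi] em[OF qi] by (simp add: p_def q_def)
    qed auto
    then have "AE x in lborel. ennreal (p x) = ennreal (q x)"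
      by (subst (asm) sigma_finite_measure.density_unique_iff[OF sigma_finite_lborel]) auto
    then show ?thesis
      by eventually_elim (auto simp: p_def q_def F_def G_def I_def indicator_def max_def split: if_splits)
  qed
  then have "AE x in lborel. \<forall>n::nat. x \<in> {-real n..real n} \<longrightarrow> f x = g x"
    unfolding AE_all_countable by blast
  then show ?thesis
  proof eventually_elim
    case (elim x)
    obtain n :: nat where "\<bar>x\<bar> \<le> real n" using real_arch_simple by blast
    then show ?case using elim by (auto simp: abs_le_iff)
  qed
qed

section \<open>Lagrangian coordinates and quantiles\<close>

lemma finite_borel_measure_on_R_iff: "finite_borel_measure_on_R \<mu> \<longleftrightarrow> finite_borel_measure \<mu>"
  by (simp add: finite_borel_measure_on_R_def finite_borel_measure_def finite_borel_measure_axioms_def)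

context finite_borel_measure
begin

lemma dist_fun_mono: "x \<le> y \<Longrightarrow> dist_fun M x \<le> dist_fun M y"
  unfolding dist_fun_def by (rule finite_measure_mono) auto

lemma dist_fun_nonneg: "0 \<le> dist_fun M x"
  by (simp add: dist_fun_def)

lemma dist_fun_le: "dist_fun M x \<le> measure M UNIV"
  unfolding dist_fun_def by (rule finite_measure_mono) auto

lemma dist_fun_at_bot: "(dist_fun M \<longlongrightarrow> 0) at_bot"
  by (rule tendsto_sandwich[OF _ _ tendsto_const cdf_lim_at_bot])
    (auto simp: dist_fun_def cdf_def intro!: always_eventually finite_measure_mono)

lemma dist_fun_at_top: "(dist_fun M \<longlongrightarrow> measure M UNIV) at_top"
proof (rule tendsto_sandwich[OF _ _ _ tendsto_const])
  \<comment> \<open>The shift by 1 places the closed half-line of \<open>cdf\<close> inside the open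
    one of \<open>dist_fun\<close>.\<close>
  show "\<forall>\<^sub>F x in at_top. cdf M (-1 + x) \<le> dist_fun M x"
    by (auto simp: dist_fun_def cdf_def intro!: always_eventually finite_measure_mono)
  show "\<forall>\<^sub>F x in at_top. dist_fun M x \<le> measure M UNIV"
    by (simp add: dist_fun_le)
  have "filterlim (\<lambda>x::real. -1 + x) at_top at_top"
    by (rule filterlim_tendsto_add_at_top[OF tendsto_const filterlim_ident])
  then show "((\<lambda>x. cdf M (-1 + x)) \<longlongrightarrow> measure M UNIV) at_top"
    using filterlim_compose[OF cdf_lim_at_top] borel_UNIV by fastforce
qed

lemma ex_dist_fun_less: "0 < \<theta> \<Longrightarrow> \<exists>x. dist_fun M x < \<theta>"
  using order_tendstoD(2)[OF dist_fun_at_bot] eventually_happens[of _ "at_bot::real filter"] by fastforce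

lemma ex_dist_fun_greater: "\<theta> < measure M UNIV \<Longrightarrow> \<exists>x. \<theta> < dist_fun M x"
  using order_tendstoD(1)[OF dist_fun_at_top] eventually_happens[of _ "at_top::real filter"] by fastforce

end

text \<open>Continuity from above recovers the right-continuous \<open>cdf\<close> as the limit of
  \<open>dist_fun\<close> along points decreasing to x, and \<open>cdf\<close> determines the
  measure.\<close>

lemma measure_eq_if_dist_fun_eq:
  assumes "finite_borel_measure \<mu>" "finite_borel_measure \<nu>" "dist_fun \<mu> = dist_fun \<nu>"
  shows "\<mu> = \<nu>"
proof (rule cdf_unique'[OF assms(1,2)], rule ext)
  fix x
  have "((\<lambda>n. x + 1 / real (Suc n)) \<longlongrightarrow> x) sequentially"
    using tendsto_add[OF tendsto_const LIMSEQ_inverse_real_of_nat, of x] by (simp add: inverse_eq_divide)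
  have lim: "(\<lambda>n. dist_fun N (x + 1 / real (Suc n))) \<longlonglongrightarrow> cdf N x" if "finite_borel_measure N" for N
  proof -
    interpret finite_borel_measure N by fact
    have le: "1 / real (Suc n) \<le> 1 / real (Suc k)" if "k \<le> n" for k n
      using that by (intro frac_le) auto
    have "decseq (\<lambda>n. {..<x + 1 / real (Suc n)})"
      unfolding decseq_def using le by (force simp del: of_nat_Suc)
    then have "(\<lambda>n. measure N {..<x + 1 / real (Suc n)}) \<longlonglongrightarrow> measure N (\<Inter>n. {..<x + 1 / real (Suc n)})"
      by (intro finite_Lim_measure_decseq) auto
    also have "(\<Inter>n. {..<x + 1 / real (Suc n)}) = {..x}"
    proof (intro equalityI subsetI)
      fix z assume z: "z \<in> (\<Inter>n. {..<x + 1 / real (Suc n)})"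
      have "z \<le> x"
        by (rule LIMSEQ_le_const[OF \<open>((\<lambda>n. x + 1 / real (Suc n)) \<longlongrightarrow> x) sequentially\<close>])
          (use z in \<open>auto intro: less_imp_le\<close>)
      then show "z \<in> {..x}" by simp
    qed (simp add: add_strict_increasing2 order_le_less_trans[of _ x])
    finally show ?thesis by (simp add: dist_fun_def cdf_def)
  qed
  show "cdf \<mu> x = cdf \<nu> x"
    using LIMSEQ_unique[OF lim[OF assms(1)]] lim[OF assms(2)] assms(3) by simp
qed

text \<open>For \<theta> strictly between 0 and the total mass the set is nonempty and bounded
  above; \<open>labels\<close> below confines \<theta> to this range.\<close>

definition quantile :: "real measure \<Rightarrow> real \<Rightarrow> real" where
  "quantile \<mu> \<theta> = Sup {x. dist_fun \<mu> x < \<theta>}"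

definition lagr_pos :: "real measure \<Rightarrow> real \<Rightarrow> real" where
  "lagr_pos \<mu> \<xi> = Sup {x. x + dist_fun \<mu> x < \<xi>}"

definition lagr_mass :: "real measure \<Rightarrow> real \<Rightarrow> real" where
  "lagr_mass \<mu> \<xi> = \<xi> - lagr_pos \<mu> \<xi>"

text \<open>The parameter here is the mass coordinate \<theta>, not the Lagrangian label \<xi>;
  measures of equal total mass thereby share one parameter space.\<close>

definition labels :: "real measure \<Rightarrow> real measure" where
  "labels \<mu> = restrict_space lborel {0<..<measure \<mu> UNIV}"

lemma L_map_eq: "L_map (u, \<mu>) = (lagr_pos \<mu>, (\<lambda>\<xi>. u (lagr_pos \<mu> \<xi>)), lagr_mass \<mu>)"
  by (simp add: L_map_def lagr_pos_def[abs_def] lagr_mass_def[abs_def] dist_fun_def Let_def)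

context finite_borel_measure
begin

lemma quantile_bdd: "\<theta> < measure M UNIV \<Longrightarrow> bdd_above {x. dist_fun M x < \<theta>}"
  using ex_dist_fun_greater[of \<theta>] dist_fun_mono unfolding bdd_above_def
  by (metis linorder_not_le mem_Collect_eq nle_le order.strict_trans)

lemma le_quantile: "dist_fun M x < \<theta> \<Longrightarrow> \<theta> < measure M UNIV \<Longrightarrow> x \<le> quantile M \<theta>"
  unfolding quantile_def by (rule cSup_upper) (auto intro: quantile_bdd)

lemma quantile_le: "\<theta> \<le> dist_fun M x \<Longrightarrow> 0 < \<theta> \<Longrightarrow> quantile M \<theta> \<le> x"
  unfolding quantile_def
  by (rule cSup_least) (use ex_dist_fun_less dist_fun_mono in \<open>auto, meson linorder_linear linorder_not_le order_trans\<close>)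

lemma quantile_mono:
  assumes "0 < \<theta>" "\<theta> \<le> \<theta>'" "\<theta>' < measure M UNIV"
  shows "quantile M \<theta> \<le> quantile M \<theta>'"
  unfolding quantile_def
  by (rule cSup_subset_mono) (use assms ex_dist_fun_less quantile_bdd in auto)

lemma lagr_pos_bdd: "bdd_above {x. x + dist_fun M x < \<xi>}"
  unfolding bdd_above_def using dist_fun_nonneg by (intro exI[of _ \<xi>]) (smt (verit) mem_Collect_eq)

lemma le_lagr_pos: "x + dist_fun M x < \<xi> \<Longrightarrow> x \<le> lagr_pos M \<xi>"
  unfolding lagr_pos_def by (rule cSup_upper) (auto intro: lagr_pos_bdd)

lemma lagr_pos_ne: "{x. x + dist_fun M x < \<xi>} \<noteq> {}"
proof -
  have "(\<xi> - measure M UNIV - 1) + dist_fun M (\<xi> - measure M UNIV - 1) < \<xi>"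
    using dist_fun_le[of "\<xi> - measure M UNIV - 1"] by simp
  then show ?thesis by blast
qed

lemma lagr_pos_le: "(\<And>z. z + dist_fun M z < \<xi> \<Longrightarrow> z \<le> x) \<Longrightarrow> lagr_pos M \<xi> \<le> x"
  unfolding lagr_pos_def by (rule cSup_least) (use lagr_pos_ne in auto)

lemma lagr_pos_mono: "\<xi> \<le> \<xi>' \<Longrightarrow> lagr_pos M \<xi> \<le> lagr_pos M \<xi>'"
  by (rule lagr_pos_le) (auto intro: le_lagr_pos)

text \<open>Shifting a point left by \<open>\<xi>' - \<xi>\<close> does not increase the
  distribution function, so \<open>lagr_pos\<close> grows at most as fast as its argument.\<close>

lemma lagr_mass_mono: 
  assumes "\<xi> \<le> \<xi>'" shows "lagr_mass M \<xi> \<le> lagr_mass M \<xi>'"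
proof -
  have "lagr_pos M \<xi>' \<le> lagr_pos M \<xi> + (\<xi>' - \<xi>)"
  proof (rule lagr_pos_le)
    fix z assume "z + dist_fun M z < \<xi>'"
    then have "z - (\<xi>' - \<xi>) + dist_fun M (z - (\<xi>' - \<xi>)) < \<xi>"
      using dist_fun_mono[of "z - (\<xi>' - \<xi>)" z] assms by auto
    from le_lagr_pos[OF this] show "z \<le> lagr_pos M \<xi> + (\<xi>' - \<xi>)" by simp
  qed
  then show ?thesis by (simp add: lagr_mass_def)
qed

lemma lagr_mass_bounds: "0 \<le> lagr_mass M \<xi>" "lagr_mass M \<xi> \<le> measure M UNIV"
proof -
  have "lagr_pos M \<xi> \<le> \<xi>"
    by (rule lagr_pos_le) (use dist_fun_nonneg in \<open>smt (verit)\<close>)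
  then show "0 \<le> lagr_mass M \<xi>" by (simp add: lagr_mass_def)
  \<comment> \<open>The slack \<open>e\<close> supplies the strict inequality that membership in the
    defining set demands.\<close>
  have "\<xi> - measure M UNIV \<le> lagr_pos M \<xi> + e" if "e > 0" for e
  proof -
    have "(\<xi> - measure M UNIV - e) + dist_fun M (\<xi> - measure M UNIV - e) < \<xi>"
      using dist_fun_le[of "\<xi> - measure M UNIV - e"] that by simp
    from le_lagr_pos[OF this] show ?thesis by simp
  qed
  then have "\<xi> - measure M UNIV \<le> lagr_pos M \<xi>" by (rule field_le_epsilon)
  then show "lagr_mass M \<xi> \<le> measure M UNIV" by (simp add: lagr_mass_def)
qed

text \<open>Both functions are monotone and add up to the identity, so neither can grow faster than
  its argument.\<close>

lemma lagr_lipschitz: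
  shows "\<bar>lagr_pos M x - lagr_pos M y\<bar> \<le> \<bar>x - y\<bar>" and "\<bar>lagr_mass M x - lagr_mass M y\<bar> \<le> \<bar>x - y\<bar>"
  using lagr_mass_mono[of x y] lagr_mass_mono[of y x] lagr_pos_mono[of x y] lagr_pos_mono[of y x]
  unfolding lagr_mass_def by linarith+

lemma lagr_continuous: "continuous_on A (lagr_pos M)" "continuous_on A (lagr_mass M)"
  by (rule lipschitz_on_continuous_on[of 1]; auto simp: lipschitz_on_def dist_real_def lagr_lipschitz)+

text \<open>Points below the quantile have distribution value less than \<theta>, and points with
  such a value lie at or below it. Hence adding \<theta> to the quantile selects the right label
  even when \<theta> lies inside a jump.\<close>

lemma lagr_pos_quantile:
  assumes "0 < \<theta>" "\<theta> < measure M UNIV"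
  shows "lagr_pos M (quantile M \<theta> + \<theta>) = quantile M \<theta>"
proof (rule antisym)
  show "lagr_pos M (quantile M \<theta> + \<theta>) \<le> quantile M \<theta>"
  proof (rule lagr_pos_le)
    fix z assume "z + dist_fun M z < quantile M \<theta> + \<theta>"
    then show "z \<le> quantile M \<theta>"
      using le_quantile[of z \<theta>] assms by (cases "dist_fun M z < \<theta>") auto
  qed
  show "quantile M \<theta> \<le> lagr_pos M (quantile M \<theta> + \<theta>)"
  proof (rule dense_le)
    fix z assume z: "z < quantile M \<theta>"
    then have "dist_fun M z < \<theta>" using quantile_le[of \<theta> z] assms by force
    with z show "z \<le> lagr_pos M (quantile M \<theta> + \<theta>)" by (intro le_lagr_pos) simp
  qed
qed

lemma lagr_mass_quantile:
  assumes "0 < \<theta>" "\<theta> < measure M UNIV"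
  shows "lagr_mass M (quantile M \<theta> + \<theta>) = \<theta>"
  using lagr_pos_quantile[OF assms] by (simp add: lagr_mass_def)

lemma measurable_quantile [measurable]: "quantile M \<in> borel_measurable (labels M)"
proof -
  have "quantile M \<in> borel_measurable (restrict_space borel {0<..<measure M UNIV})"
    by (rule borel_measurable_mono_on_fnc) (auto simp: mono_on_def intro: quantile_mono)
  then show ?thesis
    unfolding labels_def by (subst measurable_cong_sets) (auto simp: sets_restrict_space)
qed

lemma measurable_labels [measurable]: "(\<lambda>\<theta>. \<theta>) \<in> borel_measurable (labels M)"
  unfolding labels_def by (rule measurable_restrict_space1) auto

lemma space_labels: "space (labels M) = {0<..<measure M UNIV}"
  by (simp add: labels_def space_restrict_space)

lemma sets_labelsD: "A \<in> sets (labels M) \<Longrightarrow> A \<in> sets borel"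
  by (simp add: labels_def sets_restrict_space_iff)

lemma emeasure_labels: "A \<in> sets borel \<Longrightarrow> A \<subseteq> {0<..<measure M UNIV} \<Longrightarrow> emeasure (labels M) A = emeasure lborel A"
  unfolding labels_def by (rule emeasure_restrict_space) auto

lemma finite_labels: "finite_measure (labels M)"
  by (rule finite_measureI) (simp add: space_labels emeasure_labels)

text \<open>This is the measure \<open>V\<^sub>\<xi> d\<xi>\<close>, introduced as an image before
  it is known to have a density.\<close>

definition lagr_measure :: "real measure" where
  "lagr_measure = distr (labels M) borel (\<lambda>\<theta>. quantile M \<theta> + \<theta>)"

lemma finite_borel_lagr_measure: "finite_borel_measure lagr_measure"
proof -
  interpret l: finite_measure "labels M" by (rule finite_labels)
  have "finite_measure lagr_measure"
    unfolding lagr_measure_def by (rule l.finite_measure_distr) measurable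
  then show ?thesis by (simp add: finite_borel_measure_def finite_borel_measure_axioms_def lagr_measure_def)
qed

text \<open>Monotonicity of \<open>lagr_mass\<close> and its being a left inverse of
  \<open>\<theta> \<mapsto> quantile M \<theta> + \<theta>\<close> squeeze the set of admissible
  \<theta> between the open and the closed interval from 0 to \<open>lagr_mass M a\<close>.\<close>

lemma cdf_lagr_measure: "cdf lagr_measure = lagr_mass M"
proof
  fix a
  let ?m = "measure M UNIV"
  define A where "A = {\<theta> \<in> {0<..<?m}. quantile M \<theta> + \<theta> \<le> a}"
  have A: "A \<in> sets (labels M)"
    using measurable_sets[of "\<lambda>\<theta>. quantile M \<theta> + \<theta>" "labels M" borel "{..a}"]
    by (simp add: A_def vimage_def Int_def space_labels conj_commute)
  then have A': "A \<in> sets lborel"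
    by (simp add: sets_labelsD)
  have "cdf lagr_measure a = measure (labels M) A"
    unfolding cdf_def lagr_measure_def
    by (subst measure_distr) (auto simp: A_def vimage_def Int_def space_labels conj_commute)
  also have "\<dots> = measure lborel A"
    unfolding measure_def using A' by (subst emeasure_labels) (auto simp: A_def)
  also have "\<dots> = lagr_mass M a"
  proof (rule antisym)
    have "A \<subseteq> {0..lagr_mass M a}"
      using lagr_mass_quantile lagr_mass_mono by (fastforce simp: A_def)
    then have "measure lborel A \<le> measure lborel {0..lagr_mass M a}"
      using A' by (intro measure_mono_fmeasurable) (auto simp: fmeasurable_def emeasure_lborel_Icc_eq)
    then show "measure lborel A \<le> lagr_mass M a" using lagr_mass_bounds(1) by simp
    have "{0<..<lagr_mass M a} \<subseteq> A"
    proof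
      fix \<theta> assume t: "\<theta> \<in> {0<..<lagr_mass M a}"
      then have r: "0 < \<theta>" "\<theta> < ?m" using lagr_mass_bounds(2)[of a] by auto
      have "quantile M \<theta> + \<theta> \<le> a"
      proof (rule ccontr)
        assume "\<not> ?thesis"
        then have "lagr_mass M a \<le> \<theta>"
          using lagr_mass_mono[of a "quantile M \<theta> + \<theta>"] lagr_mass_quantile[OF r] by simp
        then show False using t by simp
      qed
      then show "\<theta> \<in> A" using r by (simp add: A_def)
    qed
    moreover have "A \<in> fmeasurable lborel"
      by (rule fmeasurableI2[of "{0..?m}"]) (use A' in \<open>auto simp: A_def fmeasurable_def emeasure_lborel_Icc_eq\<close>)
    ultimately have "measure lborel {0<..<lagr_mass M a} \<le> measure lborel A"
      by (intro measure_mono_fmeasurable) auto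
    then show "lagr_mass M a \<le> measure lborel A" using lagr_mass_bounds(1) by simp
  qed
  finally show "cdf lagr_measure a = lagr_mass M a" .
qed

text \<open>The preimage of a null set under
  \<open>\<theta> \<mapsto> quantile M \<theta> + \<theta>\<close> lies in its image under
  \<open>lagr_mass\<close>, and Lipschitz maps preserve null sets.\<close>

lemma absolutely_continuous_lagr_measure: "absolutely_continuous lborel lagr_measure"
  unfolding absolutely_continuous_def
proof
  fix A assume A: "A \<in> null_sets (lborel :: real measure)"
  let ?B = "{\<theta> \<in> {0<..<measure M UNIV}. quantile M \<theta> + \<theta> \<in> A}"
  have Ab: "A \<in> sets borel" using A by auto
  have "negligible A" using A by (simp add: negligible_iff_null_sets null_sets_completionI)
  then have "negligible (lagr_mass M ` A)"
    by (rule negligible_locally_Lipschitz_image[rotated])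
      (auto intro!: exI[of _ "UNIV :: real set"] exI[of _ "1 :: real"] simp: lagr_lipschitz)
  moreover have "?B \<subseteq> lagr_mass M ` A"
    using lagr_mass_quantile by (force intro!: image_eqI)
  ultimately have "negligible ?B" by (rule negligible_subset)
  have B: "?B \<in> sets (labels M)"
    using measurable_sets[of "\<lambda>\<theta>. quantile M \<theta> + \<theta>" "labels M" borel A] Ab
    by (simp add: vimage_def Int_def space_labels conj_commute)
  then have B': "?B \<in> sets lborel"
    by (simp add: sets_labelsD)
  have "emeasure lagr_measure A = emeasure (labels M) ?B"
    unfolding lagr_measure_def using Ab
    by (subst emeasure_distr) (auto simp: vimage_def Int_def space_labels conj_commute)
  also have "\<dots> = emeasure lborel ?B"
    using B' by (intro emeasure_labels) auto
  also have "\<dots> = 0"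
    using \<open>negligible ?B\<close> B' by (auto simp: negligible_iff_emeasure0)
  finally show "A \<in> null_sets lagr_measure"
    using Ab by (auto simp: lagr_measure_def)
qed

lemma Lim_lagr_mass: "Lim at_top (lagr_mass M) = measure M UNIV"
proof (rule tendsto_Lim)
  interpret N: finite_borel_measure lagr_measure by (rule finite_borel_lagr_measure)
  have "measure lagr_measure UNIV = measure M UNIV"
    unfolding lagr_measure_def
    by (subst measure_distr) (auto simp: space_labels measure_def emeasure_labels)
  then show "(lagr_mass M \<longlongrightarrow> measure M UNIV) at_top"
    using N.cdf_lim_at_top by (simp add: cdf_lagr_measure N.borel_UNIV)
qed simp

end

text \<open>A Radon-Nikodym density \<open>g\<close> of \<open>lagr_measure\<close> integrates to
  the increments of \<open>lagr_mass\<close>, so it is a weak derivative. The representative chosen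
  by \<open>weak_deriv\<close> agrees with it almost everywhere, which suffices under integrals and
  as a density.\<close>

lemma (in finite_borel_measure) weak_deriv_lagr_mass:
  assumes cut: "cutoff_pair \<chi>p \<chi>m"
  defines "w \<equiv> weak_deriv (lagr_mass M)"
  shows "density lborel (\<lambda>\<xi>. ennreal (w \<xi>)) = lagr_measure"
    and "(LINT \<eta>:{..\<xi>}|lborel. w \<eta>) = lagr_mass M \<xi>"
proof -
  interpret N: finite_borel_measure lagr_measure by (rule finite_borel_lagr_measure)
  obtain f where f[measurable]: "f \<in> borel_measurable lborel" and fN: "density lborel f = lagr_measure"
    using sigma_finite_measure.Radon_Nikodym[OF sigma_finite_lborel absolutely_continuous_lagr_measure] by (auto simp: lagr_measure_def)
  define g where "g x = enn2real (f x)" for x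
  have fin: "(\<integral>\<^sup>+x. f x \<partial>lborel) < \<infinity>"
    using N.emeasure_finite[of UNIV] unfolding fN[symmetric] by (simp add: emeasure_density less_top)
  then have fg: "AE x in lborel. f x = ennreal (g x)"
    using nn_integral_PInf_AE[of f lborel] by (auto simp: g_def less_top elim!: eventually_mono)
  have gN: "density lborel (\<lambda>x. ennreal (g x)) = lagr_measure"
    unfolding fN[symmetric] by (rule density_cong) (use fg in \<open>auto simp: g_def\<close>)
  have g0: "0 \<le> g x" for x by (simp add: g_def)
  have gm[measurable]: "g \<in> borel_measurable borel" unfolding g_def by measurable
  have gi: "integrable lborel g"
  proof (rule integrableI_nonneg)
    have "(\<integral>\<^sup>+x. ennreal (g x) \<partial>lborel) = (\<integral>\<^sup>+x. f x \<partial>lborel)"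
      by (rule nn_integral_cong_AE) (use fg in auto)
    then show "(\<integral>\<^sup>+x. ennreal (g x) \<partial>lborel) < \<infinity>" using fin by simp
  qed (auto simp: g0)
  have gA: "set_integrable lborel A g" if "A \<in> sets borel" for A
    using integrable_mult_indicator[OF _ gi, of A] that by (simp add: set_integrable_def)
  have meas: "measure lagr_measure A = (LINT x:A|lborel. g x)" if "A \<in> sets borel" for A
  proof -
    have "emeasure lagr_measure A = (\<integral>\<^sup>+x. ennreal (indicator A x *\<^sub>R g x) \<partial>lborel)"
      unfolding gN[symmetric] using that
      by (subst emeasure_density) (auto intro!: nn_integral_cong simp: indicator_def)
    also have "\<dots> = ennreal (LINT x|lborel. indicator A x *\<^sub>R g x)"
      by (rule nn_integral_eq_integral) (use gA[OF that] g0 in \<open>auto simp: set_integrable_def\<close>)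
    finally show ?thesis
      using g0 by (simp add: measure_def set_lebesgue_integral_def integral_nonneg_AE)
  qed
  have lg: "locally_integrable g"
    unfolding locally_integrable_def by (simp add: gA)
  have "has_weak_deriv (lagr_mass M) g"
  proof (rule has_weak_deriv_if_integral[OF lagr_continuous(2) lg])
    fix a b :: real assume "a \<le> b"
    \<comment> \<open>Increments of \<open>cdf\<close> measure half-open intervals; continuity rules
      out an atom at a, so the closed interval has the same mass.\<close>
    have "measure lagr_measure {a} = 0"
      unfolding N.isCont_cdf[symmetric] cdf_lagr_measure
      using lagr_continuous(2)[of UNIV] by (simp add: continuous_on_eq_continuous_at)
    have "lagr_mass M b - lagr_mass M a = measure lagr_measure {a<..b}"
      using N.emeasure_Ioc[OF \<open>a \<le> b\<close>] lagr_mass_mono[OF \<open>a \<le> b\<close>] by (simp add: cdf_lagr_measure measure_def)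
    also have "\<dots> = measure lagr_measure ({a} \<union> {a<..b})"
      by (subst N.finite_measure_Union) (auto simp: \<open>measure lagr_measure {a} = 0\<close>)
    also have "{a} \<union> {a<..b} = {a..b}" using \<open>a \<le> b\<close> by auto
    finally show "lagr_mass M b - lagr_mass M a = (LINT x:{a..b}|lborel. g x)"
      by (simp add: meas)
  qed
  then have w: "has_weak_deriv (lagr_mass M) w"
    unfolding w_def by (rule has_weak_deriv_weak_deriv)
  then have lw: "locally_integrable w" by (simp add: has_weak_deriv_def)
  have wg: "AE x in lborel. w x = g x"
    by (rule AE_eq_if_integral_Icc_eq[OF lw lg])
      (use weak_deriv_integral_Icc[OF cut _ lagr_continuous(2)] w \<open>has_weak_deriv (lagr_mass M) g\<close> in metis)
  have [measurable]: "w \<in> borel_measurable borel" by (rule locally_integrable_measurable[OF lw])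
  show "density lborel (\<lambda>\<xi>. ennreal (w \<xi>)) = lagr_measure"
    unfolding gN[symmetric] by (rule density_cong) (use wg in auto)
  have "(LINT \<eta>:{..\<xi>}|lborel. w \<eta>) = (LINT \<eta>:{..\<xi>}|lborel. g \<eta>)"
    unfolding set_lebesgue_integral_def by (rule integral_cong_AE) (use wg in auto)
  also have "\<dots> = lagr_mass M \<xi>"
    unfolding cdf_lagr_measure[symmetric] cdf_def by (subst meas) auto
  finally show "(LINT \<eta>:{..\<xi>}|lborel. w \<eta>) = lagr_mass M \<xi>" .
qed

text \<open>The integral equation for \<open>V\<close> fixes it as \<open>W\<close> at all times, so
  \<open>U\<close> has constant acceleration and \<open>y\<close> is quadratic in time. For
  uniqueness, the difference between any solution and the explicit formula has zero derivative on
  the half-line; this makes the definite description in \<open>S_map\<close> denote the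
  formula.\<close>

lemma S_map_eq:
  assumes W: "\<And>\<xi>. (LINT \<eta>:{..\<xi>}|lborel. weak_deriv W \<eta>) = W \<xi>" and lim: "Lim at_top W = m"
    and t: "0 \<le> t"
  shows "S_map t (Y, Z, W)
    = ((\<lambda>\<xi>. Y \<xi> + t * Z \<xi> + t\<^sup>2 / 4 * (W \<xi> - m / 2)), (\<lambda>\<xi>. Z \<xi> + t * (W \<xi> / 2 - m / 4)), W)"
    (is "_ = (?y t, ?U t, W)")
  unfolding S_map_def
proof (rule the_equality)
  have "lagrangian_solution (Y, Z, W) ?y ?U (\<lambda>_. W)"
    unfolding lagrangian_solution_def
    by (auto simp: W lim power2_eq_square field_simps intro!: derivative_eq_intros)
  then show "\<exists>y U V. lagrangian_solution (Y, Z, W) y U V \<and> (?y t, ?U t, W) = (y t, U t, V t)"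
    by (intro exI[of _ ?y] exI[of _ ?U] exI[of _ "\<lambda>_. W"]) simp
next
  fix X assume "\<exists>y U V. lagrangian_solution (Y, Z, W) y U V \<and> X = (y t, U t, V t)"
  then obtain y U V where sol: "lagrangian_solution (Y, Z, W) y U V" and X: "X = (y t, U t, V t)" by blast
  have init: "y 0 = Y" "U 0 = Z" "V 0 = W" using sol by (auto simp: lagrangian_solution_def)
  have V: "V s = W" if "s \<ge> 0" for s
    using sol that W by (auto simp: lagrangian_solution_def init)
  have const: "\<And>s. s \<ge> 0 \<Longrightarrow> f s = f 0" if "\<And>s. s \<ge> 0 \<Longrightarrow> (f has_real_derivative 0) (at s within {0..})" for f :: "real \<Rightarrow> real"
    using has_field_derivative_zero_constant[of "{0..}" f] that by (auto simp: convex_real_interval)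
  have U: "U s \<xi> = ?U s \<xi>" if s: "s \<ge> 0" for s \<xi>
  proof -
    have "((\<lambda>s. U s \<xi> - ?U s \<xi>) has_real_derivative 0) (at s within {0..})" if "s \<ge> 0" for s
    proof -
      have "((\<lambda>s. U s \<xi>) has_real_derivative (W \<xi> / 2 - m / 4)) (at s within {0..})"
        using sol that V[OF that] lim by (auto simp: lagrangian_solution_def)
      then show ?thesis by (auto intro!: derivative_eq_intros)
    qed
    from const[OF this s] show ?thesis by (simp add: init)
  qed
  have y: "y t \<xi> = ?y t \<xi>" for \<xi>
  proof -
    have "((\<lambda>s. y s \<xi> - ?y s \<xi>) has_real_derivative 0) (at s within {0..})" if "s \<ge> 0" for s
    proof -
      have "((\<lambda>s. y s \<xi>) has_real_derivative ?U s \<xi>) (at s within {0..})"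
        using sol that U[OF that] by (auto simp: lagrangian_solution_def)
      then show ?thesis by (auto intro!: derivative_eq_intros simp: field_simps)
    qed
    from const[OF this t] show ?thesis by (simp add: init)
  qed
  show "X = (?y t, ?U t, W)" using X y U[OF t] V[OF t] by auto
qed

text \<open>The two pushforwards, from \<theta> to \<xi> and from \<xi> to the position at time t,
  compose; on labels of the form quantile plus \<theta> the Lagrangian position and mass reduce to
  the quantile and \<theta>.\<close>

lemma (in finite_borel_measure) snd_T_map:
  assumes cut: "cutoff_pair \<chi>p \<chi>m" and t: "0 \<le> t" and [measurable]: "u \<in> borel_measurable borel"
  shows "snd (T_map t (u, M)) = distr (labels M) borel
    (\<lambda>\<theta>. quantile M \<theta> + t * u (quantile M \<theta>) + t\<^sup>2 / 4 * (\<theta> - measure M UNIV / 2))"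
proof -
  let ?m = "measure M UNIV"
  let ?y = "\<lambda>\<xi>. lagr_pos M \<xi> + t * u (lagr_pos M \<xi>) + t\<^sup>2 / 4 * (lagr_mass M \<xi> - ?m / 2)"
  have [measurable]: "lagr_pos M \<in> borel_measurable borel" "lagr_mass M \<in> borel_measurable borel"
    by (auto intro!: borel_measurable_continuous_onI lagr_continuous)
  have "snd (T_map t (u, M)) = distr (density lborel (\<lambda>\<xi>. ennreal (weak_deriv (lagr_mass M) \<xi>))) borel ?y"
    by (simp add: T_map_def L_map_eq M_map_def
        S_map_eq[OF weak_deriv_lagr_mass(2)[OF cut] Lim_lagr_mass t])
  also have "\<dots> = distr (labels M) borel (?y \<circ> (\<lambda>\<theta>. quantile M \<theta> + \<theta>))"
    unfolding weak_deriv_lagr_mass(1)[OF cut] lagr_measure_def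
    by (rule distr_distr) measurable
  also have "\<dots> = distr (labels M) borel
    (\<lambda>\<theta>. quantile M \<theta> + t * u (quantile M \<theta>) + t\<^sup>2 / 4 * (\<theta> - ?m / 2))"
    by (rule distr_cong) (auto simp: space_labels lagr_pos_quantile lagr_mass_quantile)
  finally show ?thesis .
qed

section \<open>The Eulerian set\<close>

text \<open>Reflection exchanges left and right continuity: \<open>H y = m - G (- y)\<close> is
  right-continuous and defines an interval measure, whose image under negation has the distribution
  function \<open>G\<close>.\<close>

lemma ex_measure_of_dist_fun:
  fixes G :: "real \<Rightarrow> real"
  assumes mono: "\<And>x y. x \<le> y \<Longrightarrow> G x \<le> G y" and left: "\<And>a. (G \<longlongrightarrow> G a) (at_left a)"
    and bot: "(G \<longlongrightarrow> 0) at_bot" and top: "(G \<longlongrightarrow> m) at_top"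
  shows "\<exists>\<nu>. finite_borel_measure \<nu> \<and> dist_fun \<nu> = G \<and> measure \<nu> UNIV = m"
proof -
  define H where "H y = m - G (- y)" for y
  have m: "0 \<le> m"
  proof (rule tendsto_lowerbound[OF top])
    have "0 \<le> G x" for x
      by (rule tendsto_upperbound[OF bot]) (auto simp: eventually_at_bot_linorder mono intro!: exI[of _ x])
    then show "\<forall>\<^sub>F x in at_top. 0 \<le> G x" by simp
  qed simp
  have H1: "\<And>x y. x \<le> y \<Longrightarrow> H x \<le> H y" by (simp add: H_def mono)
  have H2: "continuous (at_right a) H" for a
  proof -
    have "((\<lambda>y. G (- y)) \<longlongrightarrow> G (- a)) (at_right a)"
      using left[of "- a"] by (simp add: filterlim_at_left_to_right)
    then show ?thesis unfolding continuous_within H_def by (intro tendsto_intros)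
  qed
  have "((\<lambda>y. G (- y)) \<longlongrightarrow> m) at_bot" using top by (simp add: filterlim_at_top_mirror)
  from tendsto_diff[OF tendsto_const this, of m] have H3: "(H \<longlongrightarrow> 0) at_bot"
    by (simp add: H_def[abs_def])
  have "((\<lambda>y. G (- y)) \<longlongrightarrow> 0) at_top" using bot by (simp add: filterlim_at_bot_mirror)
  from tendsto_diff[OF tendsto_const this, of m] have H4: "(H \<longlongrightarrow> m) at_top"
    by (simp add: H_def[abs_def])
  interpret I: finite_borel_measure "interval_measure H"
    by (rule finite_borel_measure_interval_measure[OF H1 H2 H3 H4 m])
  define \<nu> where "\<nu> = distr (interval_measure H) borel uminus"
  have U: "measure (interval_measure H) UNIV = m"
    using interval_measure_UNIV[OF H1 H2 H3 H4 m] m by (simp add: measure_def)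
  have um: "uminus \<in> measurable (interval_measure H) borel"
    by (subst measurable_cong_sets[OF sets_interval_measure refl]) (auto intro: borel_measurable_continuous_onI continuous_intros)
  have meas: "measure \<nu> A = measure (interval_measure H) (uminus -` A)" if "A \<in> sets borel" for A
    unfolding \<nu>_def using that by (subst measure_distr[OF um]) auto
  have "finite_measure \<nu>" unfolding \<nu>_def by (rule I.finite_measure_distr[OF um])
  then have "finite_borel_measure \<nu>"
    by (simp add: finite_borel_measure_def finite_borel_measure_axioms_def \<nu>_def)
  moreover have "dist_fun \<nu> = G"
  proof
    fix x
    \<comment> \<open>Negation maps the open half-line below x to the complement of the closed
      half-line up to -x, on which \<open>H\<close> gives the measure.\<close>
    have "dist_fun \<nu> x = measure (interval_measure H) (UNIV - {..-x})"
      unfolding dist_fun_def by (subst meas) (auto intro!: arg_cong[where f="measure _"])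
    also have "\<dots> = m - H (- x)"
      using I.finite_measure_compl[of "{..-x}"] measure_interval_measure_Iic[OF H1 H2 H3, of "-x"]
      by (simp add: U)
    finally show "dist_fun \<nu> x = G x" by (simp add: H_def)
  qed
  moreover have "measure \<nu> UNIV = m" using meas[of UNIV] U by simp
  ultimately show ?thesis by blast
qed

text \<open>One null set \<open>K\<close> can serve both decompositions. The absolutely continuous
  part is then \<open>\<mu>\<close> off \<open>K\<close> and the singular part is
  \<open>\<mu>\<close> on \<open>K\<close>, expressions that no longer depend on the
  decomposition.\<close>

lemma lebesgue_decomposition_unique:
  assumes "lebesgue_decomposition \<mu> \<alpha> \<sigma>" "lebesgue_decomposition \<mu> \<alpha>' \<sigma>'"
  shows "\<alpha> = \<alpha>'" "\<sigma> = \<sigma>'"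
proof -
  obtain N N' where N: "N \<in> sets borel" "emeasure lborel N = 0" "emeasure \<sigma> (- N) = 0"
    and N': "N' \<in> sets borel" "emeasure lborel N' = 0" "emeasure \<sigma>' (- N') = 0"
    using assms unfolding lebesgue_decomposition_def by blast
  define K where "K = N \<union> N'"
  have K: "K \<in> sets borel" "K \<in> null_sets lborel"
    using N N' null_sets.Un[of N lborel N'] by (simp_all add: K_def null_sets_def)
  have *: "emeasure \<beta> A = emeasure \<mu> (A - K)" "emeasure \<tau> A = emeasure \<mu> (A \<inter> K)"
    if dec: "lebesgue_decomposition \<mu> \<beta> \<tau>" and P: "P \<in> sets borel" "P \<subseteq> K" "emeasure \<tau> (- P) = 0"
      and A: "A \<in> sets borel" for \<beta> \<tau> A P
  proof -
    have s[simp]: "sets \<beta> = sets borel" "sets \<tau> = sets borel"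
      and e: "\<And>A. A \<in> sets borel \<Longrightarrow> emeasure \<mu> A = emeasure \<beta> A + emeasure \<tau> A"
      and "absolutely_continuous lborel \<beta>"
      using dec unfolding lebesgue_decomposition_def by auto
    then have "K \<in> null_sets \<beta>" using K unfolding absolutely_continuous_def by auto
    then have bK: "emeasure \<beta> (A \<inter> K) = 0"
      using A by (metis Int_commute null_setsD1 null_set_Int1 s(1))
    have "emeasure \<tau> (A - K) \<le> emeasure \<tau> (- P)" using P by (intro emeasure_mono) auto
    then have tK: "emeasure \<tau> (A - K) = 0" using P by simp
    have split: "emeasure \<rho> A = emeasure \<rho> (A \<inter> K) + emeasure \<rho> (A - K)" if "sets \<rho> = sets borel" for \<rho>
      using A K that by (subst plus_emeasure) (auto intro!: arg_cong[where f="emeasure \<rho>"])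
    show "emeasure \<beta> A = emeasure \<mu> (A - K)" "emeasure \<tau> A = emeasure \<mu> (A \<inter> K)"
      using split[of \<beta>] split[of \<tau>] bK tK e[of "A - K"] e[of "A \<inter> K"] A K by auto
  qed
  show "\<alpha> = \<alpha>'"
    by (rule measure_eqI)
      (use assms *(1)[OF assms(1) N(1) _ N(3)] *(1)[OF assms(2) N'(1) _ N'(3)] in
        \<open>auto simp: lebesgue_decomposition_def K_def\<close>)
  show "\<sigma> = \<sigma>'"
    by (rule measure_eqI)
      (use assms *(2)[OF assms(1) N(1) _ N(3)] *(2)[OF assms(2) N'(1) _ N'(3)] in
        \<open>auto simp: lebesgue_decomposition_def K_def\<close>)
qed

lemma ac_part_sing_part_eq:
  assumes "lebesgue_decomposition \<mu> \<alpha> \<sigma>"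
  shows "ac_part \<mu> = \<alpha>" "sing_part \<mu> = \<sigma>"
  unfolding ac_part_def sing_part_def
  by (rule the_equality; use assms lebesgue_decomposition_unique in blast)+

text \<open>The \<open>H1\<close> part and the classically differentiable cutoff part each have
  increments that are integrals; these add, and the sum characterises a weak derivative of
  \<open>u\<close>.\<close>

lemma weak_deriv_E2:
  assumes cut: "cutoff_pair \<chi>p \<chi>m" and u: "u \<in> E2 \<chi>p \<chi>m"
  shows "continuous_on UNIV u" "has_weak_deriv u (weak_deriv u)"
proof -
  note C = cutoff_pairD[OF cut]
  obtain g a b where g: "g \<in> H1" and u_eq: "u = (\<lambda>x. g x + a * \<chi>p x + b * \<chi>m x)"
    using u unfolding E2_def by auto
  obtain g' where gc: "continuous_on UNIV g" and g': "has_weak_deriv g g'"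
    using g unfolding H1_def by auto
  have cu: "continuous_on UNIV u" unfolding u_eq
    by (intro continuous_intros gc smooth_continuous C)
  then show "continuous_on UNIV u" .
  let ?w = "\<lambda>x. g' x + (a * deriv \<chi>p x + b * deriv \<chi>m x)"
  have i1: "set_integrable lborel {c..d} g'" for c d
    using g' unfolding has_weak_deriv_def locally_integrable_def by blast
  have "continuous_on UNIV (\<lambda>x. a * deriv \<chi>p x + b * deriv \<chi>m x)"
    by (intro continuous_intros smooth_continuous_deriv C)
  then have i2: "set_integrable lborel {c..d} (\<lambda>x. a * deriv \<chi>p x + b * deriv \<chi>m x)" for c d
    using locally_integrable_continuous unfolding locally_integrable_def by blast
  have "has_weak_deriv u ?w"
  proof (rule has_weak_deriv_if_integral[OF cu])
    show "locally_integrable ?w"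
      unfolding locally_integrable_def by (intro allI set_integral_add(1) i1 i2)
    fix c d :: real assume cd: "c \<le> d"
    have "(LINT x:{c..d}|lborel. ?w x) = (LINT x:{c..d}|lborel. g' x) + (LINT x:{c..d}|lborel. a * deriv \<chi>p x + b * deriv \<chi>m x)"
      by (intro set_integral_add(2) i1 i2)
    also have "(LINT x:{c..d}|lborel. g' x) = g d - g c"
      by (rule weak_deriv_integral_Icc[OF cut g' gc cd])
    also have "(LINT x:{c..d}|lborel. a * deriv \<chi>p x + b * deriv \<chi>m x)
        = (a * \<chi>p d + b * \<chi>m d) - (a * \<chi>p c + b * \<chi>m c)"
      unfolding set_lebesgue_integral_def
      by (rule integral_FTC_atLeastAtMost[OF cd])
        (auto simp: has_real_derivative_iff_has_vector_derivative[symmetric]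
          intro!: continuous_intros smooth_continuous_deriv C DERIV_add DERIV_cmult
            DERIV_subset[OF smooth_has_deriv])
    finally show "u d - u c = (LINT x:{c..d}|lborel. ?w x)" by (simp add: u_eq)
  qed
  then show "has_weak_deriv u (weak_deriv u)" by (rule has_weak_deriv_weak_deriv)
qed

lemma set_integral_Cauchy_Schwarz:
  fixes w :: "real \<Rightarrow> real"
  assumes "a \<le> b" and w: "set_integrable lborel {a..b} w" and w2: "set_integrable lborel {a..b} (\<lambda>x. (w x)\<^sup>2)"
  shows "(LINT x:{a..b}|lborel. w x)\<^sup>2 \<le> (b - a) * (LINT x:{a..b}|lborel. (w x)\<^sup>2)"
proof (cases "a = b")
  case True
  have "AE x in lborel. indicator {a..b} x *\<^sub>R w x = 0"
    using AE_lborel_singleton[of a] by eventually_elim (use True in auto)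
  then show ?thesis
    using True by (simp add: set_lebesgue_integral_def integral_eq_zero_AE)
next
  case False
  define I where "I = (LINT x:{a..b}|lborel. w x)"
  \<comment> \<open>The mean value of \<open>w\<close> minimises the integral of
    \<open>(w - c)\<^sup>2\<close>, whose nonnegativity then is the claim.\<close>
  define c where "c = I / (b - a)"
  have one: "set_integrable lborel {a..b} (\<lambda>x. c\<^sup>2)"
    using locally_integrable_continuous[of "\<lambda>_. c\<^sup>2"] by (auto simp: locally_integrable_def)
  have "0 \<le> (LINT x:{a..b}|lborel. (w x - c)\<^sup>2)"
    unfolding set_lebesgue_integral_def by (rule integral_nonneg_AE) auto
  also have "\<dots> = (LINT x:{a..b}|lborel. (w x)\<^sup>2 - (2 * c) * w x + c\<^sup>2)"
    by (simp add: power2_diff algebra_simps)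
  also have "\<dots> = (LINT x:{a..b}|lborel. (w x)\<^sup>2) - (2 * c) * I + c\<^sup>2 * (b - a)"
    using w w2 one \<open>a \<le> b\<close> by (subst set_integral_add; (subst set_integral_diff)?)
      (auto simp: I_def set_integral_diff set_lebesgue_integral_def)
  also have "\<dots> = (LINT x:{a..b}|lborel. (w x)\<^sup>2) - I\<^sup>2 / (b - a)"
    using False by (simp add: c_def power2_eq_square)
  finally have "I\<^sup>2 / (b - a) \<le> (LINT x:{a..b}|lborel. (w x)\<^sup>2)" by simp
  then show ?thesis using False \<open>a \<le> b\<close> by (simp add: I_def divide_le_eq mult.commute)
qed

text \<open>The last claim is Cauchy-Schwarz for the weak derivative, whose square is the density of
  the absolutely continuous part. It makes the radicand in \<open>grid_q\<close> nonnegative and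
  controls the oscillation of \<open>u\<close> by mass.\<close>

lemma eulerian_setD:
  assumes cut: "cutoff_pair \<chi>p \<chi>m" and "(u, \<mu>) \<in> eulerian_set \<chi>p \<chi>m"
  shows "finite_borel_measure \<mu>" "continuous_on UNIV u"
    "finite_borel_measure (ac_part \<mu>)" "finite_borel_measure (sing_part \<mu>)"
    "dist_fun \<mu> x = dist_fun (ac_part \<mu>) x + dist_fun (sing_part \<mu>) x"
    "a \<le> b \<Longrightarrow> (u b - u a)\<^sup>2 \<le> (b - a) * (dist_fun (ac_part \<mu>) b - dist_fun (ac_part \<mu>) a)"
proof -
  define w where "w = weak_deriv u"
  obtain \<sigma> where u: "u \<in> E2 \<chi>p \<chi>m" and fb: "finite_borel_measure_on_R \<mu>"
    and dec: "lebesgue_decomposition \<mu> (density lborel (\<lambda>x. ennreal ((w x)\<^sup>2))) \<sigma>"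
    using assms(2) by (auto simp: eulerian_set_def w_def)
  define \<alpha> where "\<alpha> = density lborel (\<lambda>x. ennreal ((w x)\<^sup>2))"
  note parts = ac_part_sing_part_eq[OF dec, folded \<alpha>_def]
  show fb': "finite_borel_measure \<mu>" using fb by (simp add: finite_borel_measure_on_R_iff)
  interpret M: finite_borel_measure \<mu> by fact
  show uc: "continuous_on UNIV u" by (rule weak_deriv_E2(1)[OF cut u])
  have w: "has_weak_deriv u w" unfolding w_def by (rule weak_deriv_E2(2)[OF cut u])
  then have lw: "locally_integrable w" by (simp add: has_weak_deriv_def)
  have [measurable]: "w \<in> borel_measurable borel" by (rule locally_integrable_measurable[OF lw])
  have s: "sets \<alpha> = sets borel" "sets \<sigma> = sets borel"
    and e: "\<And>A. A \<in> sets borel \<Longrightarrow> emeasure \<mu> A = emeasure \<alpha> A + emeasure \<sigma> A"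
    using dec unfolding lebesgue_decomposition_def \<alpha>_def by auto
  have "emeasure \<alpha> UNIV + emeasure \<sigma> UNIV < \<infinity>"
    using e[of UNIV] M.emeasure_finite[of UNIV] by (simp add: less_top)
  then have fin: "emeasure \<alpha> UNIV < \<infinity>" "emeasure \<sigma> UNIV < \<infinity>"
    by (auto simp: less_top[symmetric])
  have sp: "space \<alpha> = UNIV" "space \<sigma> = UNIV" using s by (auto dest: sets_eq_imp_space_eq)
  have fa: "finite_borel_measure \<alpha>" and fs: "finite_borel_measure \<sigma>"
    using fin s sp by (auto simp: finite_borel_measure_def finite_borel_measure_axioms_def
        less_top intro!: finite_measureI)
  then show "finite_borel_measure (ac_part \<mu>)" "finite_borel_measure (sing_part \<mu>)"
    by (simp_all add: parts)
  interpret A: finite_borel_measure \<alpha> by fact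
  interpret S: finite_borel_measure \<sigma> by fact
  have "measure \<mu> B = measure \<alpha> B + measure \<sigma> B" if "B \<in> sets borel" for B
    using e[OF that] by (simp add: M.emeasure_eq_measure A.emeasure_eq_measure S.emeasure_eq_measure
        flip: ennreal_plus)
  then show "dist_fun \<mu> x = dist_fun (ac_part \<mu>) x + dist_fun (sing_part \<mu>) x"
    by (simp add: dist_fun_def parts)
  have w2: "integrable lborel (\<lambda>x. (w x)\<^sup>2)"
    by (rule integrableI_nonneg) (use fin in \<open>auto simp: \<alpha>_def emeasure_density\<close>)
  have w2A: "set_integrable lborel B (\<lambda>x. (w x)\<^sup>2)" if "B \<in> sets borel" for B
    using integrable_mult_indicator[OF _ w2, of B] that by (simp add: set_integrable_def)
  have meas: "measure \<alpha> B = (LINT x:B|lborel. (w x)\<^sup>2)" if "B \<in> sets borel" for B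
  proof -
    have "emeasure \<alpha> B = (\<integral>\<^sup>+x. ennreal (indicator B x *\<^sub>R (w x)\<^sup>2) \<partial>lborel)"
      unfolding \<alpha>_def using that
      by (subst emeasure_density) (auto intro!: nn_integral_cong simp: indicator_def)
    also have "\<dots> = ennreal (LINT x|lborel. indicator B x *\<^sub>R (w x)\<^sup>2)"
      by (rule nn_integral_eq_integral) (use w2A[OF that] in \<open>auto simp: set_integrable_def\<close>)
    finally show ?thesis
      by (simp add: measure_def set_lebesgue_integral_def integral_nonneg_AE)
  qed
  assume ab: "a \<le> b"
  have "(u b - u a)\<^sup>2 = (LINT x:{a..b}|lborel. w x)\<^sup>2"
    using weak_deriv_integral_Icc[OF cut w uc ab] by simp
  also have "\<dots> \<le> (b - a) * (LINT x:{a..b}|lborel. (w x)\<^sup>2)"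
    by (rule set_integral_Cauchy_Schwarz[OF ab]) (use lw w2A in \<open>auto simp: locally_integrable_def\<close>)
  \<comment> \<open>Increments of the left-continuous distribution function measure intervals closed
    on the left and open on the right.\<close>
  also have "(LINT x:{a..b}|lborel. (w x)\<^sup>2) = (LINT x:{a..<b}|lborel. (w x)\<^sup>2)"
    unfolding set_lebesgue_integral_def
  proof (rule integral_cong_AE)
    show "AE x in lborel. indicator {a..b} x *\<^sub>R (w x)\<^sup>2 = indicator {a..<b} x *\<^sub>R (w x)\<^sup>2"
      using AE_lborel_singleton[of b] by eventually_elim (auto simp: indicator_def)
  qed auto
  also have "\<dots> = measure \<alpha> {a..<b}" by (simp add: meas)
  also have "{a..<b} = {..<b} - {..<a}" by auto
  also have "measure \<alpha> \<dots> = dist_fun \<alpha> b - dist_fun \<alpha> a"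
    unfolding dist_fun_def using ab by (intro A.finite_measure_Diff) (auto simp: s)
  finally show "(u b - u a)\<^sup>2 \<le> (b - a) * (dist_fun (ac_part \<mu>) b - dist_fun (ac_part \<mu>) a)"
    by (simp add: parts)
qed

section \<open>The projection\<close>

lemma cell_bounds:
  assumes "0 < h"
  shows "of_int (2 * cell h x) * h < x" "x \<le> of_int (2 * cell h x + 2) * h"
proof -
  have "of_int (cell h x) < x / (2 * h)" "x / (2 * h) \<le> of_int (cell h x) + 1"
    using ceiling_correct[of "x / (2 * h)"] by (auto simp: cell_def)
  then show "of_int (2 * cell h x) * h < x" "x \<le> of_int (2 * cell h x + 2) * h"
    using assms by (auto simp: field_simps)
qed

lemma cell_eqI:
  assumes "0 < h" "of_int (2 * j) * h < x" "x \<le> of_int (2 * j + 2) * h"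
  shows "cell h x = j"
proof -
  have "\<lceil>x / (2 * h)\<rceil> = j + 1"
    by (rule ceiling_unique) (use assms in \<open>auto simp: field_simps\<close>)
  then show ?thesis by (simp add: cell_def)
qed

text \<open>For a fixed cell index the formula is piecewise affine, and the index takes countably
  many values.\<close>

lemma measurable_proj_u [measurable]: "proj_u h s u Fac \<in> borel_measurable borel"
proof -
  have [measurable]: "cell h \<in> measurable borel (count_space UNIV)"
    unfolding cell_def by measurable
  define g where "g j x = (if x \<le> of_int (2*j+1) * h
      then u (of_int (2*j) * h) + (grid_D h u j - s j * grid_q h u Fac j) * (x - of_int (2*j) * h)
      else u (of_int (2*j+2) * h) + (grid_D h u j + s j * grid_q h u Fac j) * (x - of_int (2*j+2) * h))"
    for j :: int and x
  have "(\<lambda>x. g (cell h x) x) \<in> borel_measurable borel"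
    by (rule measurable_compose_countable) (auto simp: g_def)
  also have "(\<lambda>x. g (cell h x) x) = proj_u h s u Fac"
    by (rule ext) (simp only: g_def proj_u_def Let_def)
  finally show ?thesis .
qed

text \<open>The distribution functions enter as plain functions; \<open>CS\<close> is the increment
  bound from \<open>eulerian_setD\<close>.\<close>

locale projection =
  fixes h :: real and s :: "int \<Rightarrow> real" and u Fac Fsing :: "real \<Rightarrow> real"
  assumes h: "0 < h" and s: "s j \<in> {1, -1}"
    and mono: "a \<le> b \<Longrightarrow> Fac a \<le> Fac b" "a \<le> b \<Longrightarrow> Fsing a \<le> Fsing b"
    and CS: "a \<le> b \<Longrightarrow> (u b - u a)\<^sup>2 \<le> (b - a) * (Fac b - Fac a)"
begin

abbreviation x0 :: "int \<Rightarrow> real" where "x0 j \<equiv> of_int (2 * j) * h"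
abbreviation x1 :: "int \<Rightarrow> real" where "x1 j \<equiv> of_int (2 * j + 1) * h"
abbreviation x2 :: "int \<Rightarrow> real" where "x2 j \<equiv> of_int (2 * j + 2) * h"
abbreviation Du :: "int \<Rightarrow> real" where "Du \<equiv> grid_D h u"
abbreviation q :: "int \<Rightarrow> real" where "q \<equiv> grid_q h u Fac"

abbreviation F :: "real \<Rightarrow> real" where "F x \<equiv> Fac x + Fsing x"
abbreviation PF :: "real \<Rightarrow> real" where "PF x \<equiv> proj_Fac h s u Fac x + proj_Fsing h Fsing x"

lemma grid: "x1 j = x0 j + h" "x2 j = x0 j + 2 * h"
  by (simp_all add: algebra_simps)

text \<open>\<open>CS\<close> over one cell says that the radicand defining \<open>q\<close> is
  nonnegative, so squaring undoes the square root.\<close>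

lemma q_square: "(Du j)\<^sup>2 + (q j)\<^sup>2 = (Fac (x2 j) - Fac (x0 j)) / (2 * h)"
proof -
  have "(u (x2 j) - u (x0 j))\<^sup>2 \<le> 2 * h * (Fac (x2 j) - Fac (x0 j))"
    using CS[of "x0 j" "x2 j"] h by (simp only: grid)  simp
  then have "(u (x2 j) - u (x0 j))\<^sup>2 / (2 * h)\<^sup>2 \<le> 2 * h * (Fac (x2 j) - Fac (x0 j)) / (2 * h)\<^sup>2"
    by (rule divide_right_mono) simp
  also have "2 * h * k / (2 * h)\<^sup>2 = k / (2 * h)" for k
    using h by (simp add: power2_eq_square)
  also have "(Fac (x2 j) - Fac (x0 j)) / (2 * h) = grid_D h Fac j"
    by (simp only: grid_D_def)
  finally have "(Du j)\<^sup>2 \<le> grid_D h Fac j"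
    by (simp only: grid_D_def power_divide)
  then show ?thesis by (simp add: grid_q_def) (simp add: grid_D_def)
qed

lemma s_square: "(s j)\<^sup>2 = 1"
  using s[of j] by auto

text \<open>Parallelogram identity: the cross terms cancel whatever the sign \<open>s j\<close>.
  Multiplied by \<open>h\<close>, this says that the projection preserves the absolutely continuous
  mass of each cell.\<close>

lemma slopes: "(Du j - s j * q j)\<^sup>2 + (Du j + s j * q j)\<^sup>2 = (Fac (x2 j) - Fac (x0 j)) / h"
proof -
  have "(Du j - s j * q j)\<^sup>2 + (Du j + s j * q j)\<^sup>2 = 2 * ((Du j)\<^sup>2 + (q j)\<^sup>2 * (s j)\<^sup>2)"
    by (simp add: power2_eq_square algebra_simps)
  moreover have "2 * (k / (2 * h)) = k / h" for k :: real by simp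
  ultimately show ?thesis by (simp only: s_square q_square mult_1_right)
qed

text \<open>The formula of cell \<open>j\<close> extended to the whole line; \<open>min\<close> and
  \<open>max\<close> switch between the two slopes at \<open>x1 j\<close>. At \<open>x0 j\<close> it
  already contains the singular mass placed in the cell, unlike \<open>PF\<close>.\<close>

definition G :: "int \<Rightarrow> real \<Rightarrow> real" where
  "G j x = Fac (x0 j) + (Du j - s j * q j)\<^sup>2 * min (x - x0 j) h
     + (Du j + s j * q j)\<^sup>2 * max 0 (x - x1 j) + Fsing (x2 j)"

lemma PF_eq_G:
  assumes "x0 j < x" "x \<le> x2 j"
  shows "PF x = G j x"
proof -
  have c: "cell h x = j" by (rule cell_eqI[OF h assms])
  \<comment> \<open>The constant used in the second half is the value that the first half attains at
    \<open>x1 j\<close>, so the two pieces join continuously.\<close>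
  have e: "1/2 * (Fac (x2 j) + Fac (x0 j)) - s j * 2 * q j * Du j * h
      = Fac (x0 j) + (Du j - s j * q j)\<^sup>2 * h"
  proof -
    have "(Du j - s j * q j)\<^sup>2 * h = ((Du j)\<^sup>2 + (q j)\<^sup>2 * (s j)\<^sup>2) * h - s j * 2 * q j * Du j * h"
      by (simp add: power2_eq_square algebra_simps)
    moreover have "k / (2 * h) * h = k / 2" for k using h by simp
    ultimately show ?thesis by (simp only: s_square q_square mult_1_right) argo
  qed
  show ?thesis
  proof (cases "x \<le> x1 j")
    case True
    then have "min (x - x0 j) h = x - x0 j" "max 0 (x - x1 j) = 0" unfolding grid by simp_all
    then show ?thesis
      unfolding proj_Fac_def proj_Fsing_def c Let_def G_def
      by (simp only: True if_True mult_zero_right add_0_right)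
  next
    case False
    then have "min (x - x0 j) h = h" "max 0 (x - x1 j) = x - x1 j" unfolding grid by simp_all
    then show ?thesis
      unfolding proj_Fac_def proj_Fsing_def c Let_def G_def
      by (simp only: False if_False e)
  qed
qed

lemma G_mono: "a \<le> b \<Longrightarrow> G j a \<le> G j b"
  unfolding G_def by (intro add_mono mult_left_mono order_refl) auto

lemma G_continuous: "continuous_on A (G j)"
  unfolding G_def by (intro continuous_intros)

lemma G_x2: "G j (x2 j) = F (x2 j)"
proof -
  have "G j (x2 j) = Fac (x0 j) + ((Du j - s j * q j)\<^sup>2 + (Du j + s j * q j)\<^sup>2) * h + Fsing (x2 j)"
    using h by (simp add: G_def grid algebra_simps)
  then show ?thesis using h by (simp add: slopes)
qed

lemma G_x0: "F (x0 j) \<le> G j (x0 j)"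
  using h mono(2)[of "x0 j" "x2 j"] by (simp add: G_def grid)

lemma PF_x2: "PF (x2 j) = F (x2 j)"
proof -
  have "x0 j < x2 j" using h unfolding grid by simp
  from PF_eq_G[OF this order_refl] show ?thesis unfolding G_x2 .
qed

text \<open>Cells are open on the left, so \<open>x0 j\<close> is the right end of cell
  \<open>j - 1\<close>.\<close>

lemma PF_x0: "PF (x0 j) = F (x0 j)"
  using PF_x2[of "j - 1"] by (simp add: algebra_simps)

lemma F_mono: "a \<le> b \<Longrightarrow> F a \<le> F b"
  by (intro add_mono mono)

lemma PF_bounds:
  assumes "x0 j < x" "x \<le> x2 j"
  shows "F (x0 j) \<le> PF x" "PF x \<le> F (x2 j)"
proof -
  show "F (x0 j) \<le> PF x"
    using G_x0[of j] G_mono[of "x0 j" x j] assms by (simp add: PF_eq_G[OF assms])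
  show "PF x \<le> F (x2 j)"
    using G_x2[of j] G_mono[of x "x2 j" j] assms by (simp add: PF_eq_G[OF assms])
qed

text \<open>Within a cell this is monotonicity of \<open>G\<close>; across cells the values are
  separated by those of \<open>F\<close> at grid points, where \<open>F\<close> is monotone.\<close>

lemma PF_mono:
  assumes "x \<le> y"
  shows "PF x \<le> PF y"
proof -
  define i where "i = cell h x"
  define j where "j = cell h y"
  have x: "x0 i < x" "x \<le> x2 i" and y: "x0 j < y" "y \<le> x2 j"
    unfolding i_def j_def by (intro cell_bounds h)+
  consider "i = j" | "i < j" | "j < i" by linarith
  then show ?thesis
  proof cases
    case 1
    then show ?thesis using PF_eq_G[OF x] PF_eq_G[OF y] G_mono[OF assms, of j] by simp
  next
    case 2
    have "PF x \<le> F (x2 i)" by (rule PF_bounds[OF x])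
    also have "\<dots> \<le> F (x0 j)" using 2 h by (intro F_mono mult_right_mono) auto
    also have "\<dots> \<le> PF y" by (rule PF_bounds[OF y])
    finally show ?thesis .
  next
    case 3
    \<comment> \<open>A cell of y lying before the cell of x contradicts
      \<open>x \<le> y\<close>.\<close>
    then have "x2 j \<le> x0 i" using h by (intro mult_right_mono) auto
    then show ?thesis using x y assms by linarith
  qed
qed

text \<open>Since cells are open on the left, points slightly left of \<open>a\<close> belong to the
  same cell, where \<open>PF\<close> is the continuous \<open>G j\<close>.\<close>

lemma PF_left_continuous: "(PF \<longlongrightarrow> PF a) (at_left a)"
proof -
  define j where "j = cell h a"
  have a: "x0 j < a" "a \<le> x2 j" unfolding j_def by (intro cell_bounds h)+
  have "isCont (G j) a"
    using G_continuous[of UNIV] by (simp add: continuous_on_eq_continuous_at)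
  then have lim: "(G j \<longlongrightarrow> PF a) (at_left a)"
    unfolding PF_eq_G[OF a] isCont_def by (rule filterlim_mono) (auto simp: at_le)
  have "\<forall>\<^sub>F x in at_left a. G j x = PF x"
    using eventually_at_left_real[OF a(1)]
    by eventually_elim (use a PF_eq_G in auto)
  then show ?thesis by (rule Lim_transform_eventually[OF lim])
qed

text \<open>A cell has length \<open>2 * h\<close>, so its ends are within that distance of x; the
  limits of \<open>F\<close> at both infinities thereby pass to \<open>PF\<close>.\<close>

lemma PF_sandwich: "F (x - 2 * h) \<le> PF x" "PF x \<le> F (x + 2 * h)"
proof -
  define j where "j = cell h x"
  have x: "x0 j < x" "x \<le> x2 j" unfolding j_def by (intro cell_bounds h)+
  have "F (x - 2 * h) \<le> F (x0 j)" using x(2) unfolding grid by (intro F_mono) simp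
  then show "F (x - 2 * h) \<le> PF x" using PF_bounds(1)[OF x] by linarith
  have "F (x2 j) \<le> F (x + 2 * h)" using x(1) unfolding grid by (intro F_mono) simp
  then show "PF x \<le> F (x + 2 * h)" using PF_bounds(2)[OF x] by linarith
qed

lemma PF_at_bot:
  assumes "(F \<longlongrightarrow> 0) at_bot"
  shows "(PF \<longlongrightarrow> 0) at_bot"
proof (rule tendsto_sandwich)
  have "filterlim (\<lambda>x::real. x + c) at_bot at_bot" for c
    unfolding filterlim_at_bot eventually_at_bot_linorder
    by (metis add_le_cancel_right diff_add_cancel)
  from filterlim_compose[OF assms this]
  show "((\<lambda>x. F (x - 2 * h)) \<longlongrightarrow> 0) at_bot" "((\<lambda>x. F (x + 2 * h)) \<longlongrightarrow> 0) at_bot"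
    unfolding diff_conv_add_uminus by this+
qed (auto simp: PF_sandwich)

lemma PF_at_top:
  assumes "(F \<longlongrightarrow> m) at_top"
  shows "(PF \<longlongrightarrow> m) at_top"
proof (rule tendsto_sandwich)
  have "filterlim (\<lambda>x::real. x + c) at_top at_top" for c
    unfolding filterlim_at_top eventually_at_top_linorder
    by (metis add_le_cancel_right diff_add_cancel)
  from filterlim_compose[OF assms this]
  show "((\<lambda>x. F (x - 2 * h)) \<longlongrightarrow> m) at_top" "((\<lambda>x. F (x + 2 * h)) \<longlongrightarrow> m) at_top"
    unfolding diff_conv_add_uminus by this+
qed (auto simp: PF_sandwich)

text \<open>In each half \<open>proj_u\<close> is affine and matches \<open>u\<close> at the outer
  end. By \<open>slopes\<close> the squared slope is at most \<open>m / h\<close>, so over a length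
  \<open>h\<close> the change is at most \<open>sqrt (h * m)\<close>.\<close>

lemma proj_u_bound:
  assumes x: "x0 j \<le> x" "x \<le> x2 j" and m: "Fac (x2 j) - Fac (x0 j) \<le> m"
  shows "\<bar>proj_u h s u Fac x - u (x0 j)\<bar> \<le> sqrt (h * m) \<or> \<bar>proj_u h s u Fac x - u (x2 j)\<bar> \<le> sqrt (h * m)"
proof (cases "x = x0 j")
  \<comment> \<open>The left end is evaluated in cell \<open>j - 1\<close>, as its right end, where
    \<open>proj_u\<close> equals \<open>u\<close>.\<close>
  case True
  have "0 \<le> m" using mono(1)[of "x0 j" "x2 j"] m h by (simp add: grid)
  have c: "cell h x = j - 1" by (rule cell_eqI[OF h]) (use h True in \<open>auto simp: algebra_simps\<close>)
  have "\<not> x \<le> of_int (2 * (j - 1) + 1) * h" using h True by (simp add: algebra_simps)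
  then have "proj_u h s u Fac x = u (x0 j)"
    unfolding proj_u_def c Let_def using True by (simp add: algebra_simps)
  then show ?thesis using \<open>0 \<le> m\<close> h by simp
next
  case False
  have c: "cell h x = j" by (rule cell_eqI[OF h]) (use x False in auto)
  have slope: "\<bar>d * z\<bar> \<le> sqrt (h * m)"
    if "d\<^sup>2 \<le> (Du j - s j * q j)\<^sup>2 + (Du j + s j * q j)\<^sup>2" "\<bar>z\<bar> \<le> h" for d z
  proof (rule real_le_rsqrt)
    have "\<bar>d * z\<bar>\<^sup>2 = d\<^sup>2 * z\<^sup>2" by (simp add: power_mult_distrib)
    also have "\<dots> \<le> ((Fac (x2 j) - Fac (x0 j)) / h) * h\<^sup>2"
      using that h unfolding slopes by (intro mult_mono) (auto simp: abs_le_square_iff[symmetric] intro: order_trans[OF zero_le_power2])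
    also have "\<dots> = h * (Fac (x2 j) - Fac (x0 j))" using h by (simp add: power2_eq_square)
    also have "\<dots> \<le> h * m" using m h by (intro mult_left_mono) auto
    finally show "\<bar>d * z\<bar>\<^sup>2 \<le> h * m" .
  qed
  show ?thesis
  proof (cases "x \<le> x1 j")
    case True
    then have "proj_u h s u Fac x - u (x0 j) = (Du j - s j * q j) * (x - x0 j)"
      unfolding proj_u_def c Let_def by simp
    moreover have "\<bar>x - x0 j\<bar> \<le> h" using x True unfolding grid by simp
    ultimately show ?thesis using slope[of "Du j - s j * q j" "x - x0 j"] by simp
  next
    case False
    then have "proj_u h s u Fac x - u (x2 j) = (Du j + s j * q j) * (x - x2 j)"
      unfolding proj_u_def c Let_def by simp
    moreover have "\<bar>x - x2 j\<bar> \<le> h" using x False unfolding grid by simp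
    ultimately show ?thesis using slope[of "Du j + s j * q j" "x - x2 j"] by simp
  qed
qed

lemma u_bound:
  assumes "a \<le> b" "b - a \<le> 2 * h" "Fac b - Fac a \<le> m"
  shows "\<bar>u b - u a\<bar> \<le> sqrt 2 * sqrt (h * m)"
proof -
  have "\<bar>u b - u a\<bar>\<^sup>2 \<le> (b - a) * (Fac b - Fac a)" using CS[OF assms(1)] by simp
  also have "\<dots> \<le> (2 * h) * m"
    using assms mono(1)[OF assms(1)] h by (intro mult_mono) auto
  finally have "\<bar>u b - u a\<bar> \<le> sqrt ((2 * h) * m)" by (rule real_le_rsqrt)
  then show ?thesis by (simp add: real_sqrt_mult)
qed

text \<open>The comparison passes through whichever end of the cell \<open>proj_u_bound\<close>
  provides: \<open>sqrt 2\<close> pays for moving \<open>u\<close> from x to that end across at most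
  \<open>2 * h\<close>, and 1 pays for the projected function.\<close>

lemma proj_u_diff_bound:
  assumes x: "x0 j \<le> x" "x \<le> x2 j" and y: "x0 j \<le> y" "y \<le> x2 j"
    and m: "\<And>a b. Fac b - Fac a \<le> m"
  shows "\<bar>u x - proj_u h s u Fac y\<bar> \<le> (1 + sqrt 2) * sqrt (h * m)"
proof -
  have "x2 j - x \<le> 2 * h" "x - x0 j \<le> 2 * h" using x unfolding grid by simp_all
  then have "\<bar>u x - u (x0 j)\<bar> \<le> sqrt 2 * sqrt (h * m)" "\<bar>u (x2 j) - u x\<bar> \<le> sqrt 2 * sqrt (h * m)"
    using u_bound m x by blast+
  moreover have "(1 + sqrt 2) * sqrt (h * m) = sqrt (h * m) + sqrt 2 * sqrt (h * m)"
    by (simp add: distrib_right)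
  ultimately show ?thesis using proj_u_bound[OF y m] by linarith
qed

end

section \<open>The estimate\<close>

text \<open>The cell is located by distribution values at even grid points rather than by the
  quantile, because these values are what the projection preserves.\<close>

lemma (in finite_borel_measure) ex_cell_quantile:
  assumes "0 < h" "0 < \<theta>" "\<theta> < measure M UNIV"
  shows "\<exists>j. dist_fun M (of_int (2 * j) * h) < \<theta> \<and> \<theta> \<le> dist_fun M (of_int (2 * j + 2) * h)"
proof -
  define j where "j = cell h (quantile M \<theta>)"
  have j: "of_int (2 * j) * h < quantile M \<theta>" "quantile M \<theta> \<le> of_int (2 * j + 2) * h"
    unfolding j_def by (intro cell_bounds assms)+
  have less: "dist_fun M (of_int (2 * j) * h) < \<theta>"
    using quantile_le[of \<theta> "of_int (2 * j) * h"] assms j(1) by fastforce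
  show ?thesis
  proof (cases "\<theta> \<le> dist_fun M (of_int (2 * j + 2) * h)")
    case True
    with less show ?thesis by blast
  next
    \<comment> \<open>Here the quantile sits exactly at the right end, where the distribution
      function jumps past \<theta>; the next cell takes over.\<close>
    case False
    have "quantile M \<theta> < of_int (2 * (j + 1) + 2) * h"
      using j(2) assms by (simp add: algebra_simps)
    then have "\<theta> \<le> dist_fun M (of_int (2 * (j + 1) + 2) * h)"
      using le_quantile[of "of_int (2 * (j + 1) + 2) * h" \<theta>] assms by force
    with False show ?thesis by (intro exI[of _ "j + 1"]) (simp add: algebra_simps)
  qed
qed

text \<open>The supremum part of the norm is nonnegative, so the bound 1 applies to the Lipschitz
  quotient alone.\<close>

lemma bl_functionD:
  assumes "bl_function \<psi>" "bl_norm \<psi> \<le> 1"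
  shows "\<bar>\<psi> x - \<psi> y\<bar> \<le> \<bar>x - y\<bar>" "\<exists>B. \<forall>x. \<bar>\<psi> x\<bar> \<le> B" "\<psi> \<in> borel_measurable borel"
proof -
  obtain C where C: "C-lipschitz_on UNIV \<psi>" and b: "bounded (range \<psi>)"
    using assms(1) unfolding bl_function_def by auto
  from b obtain B where B: "\<And>x. \<bar>\<psi> x\<bar> \<le> B" by (auto simp: bounded_iff)
  then show "\<exists>B. \<forall>x. \<bar>\<psi> x\<bar> \<le> B" by blast
  show "\<psi> \<in> borel_measurable borel"
    by (rule borel_measurable_continuous_onI[OF lipschitz_on_continuous_on[OF C]])
  have "0 \<le> \<bar>\<psi> 0\<bar>" by simp
  also have "\<bar>\<psi> 0\<bar> \<le> (SUP x. \<bar>\<psi> x\<bar>)"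
    by (rule cSUP_upper) (use B in \<open>auto simp: bdd_above_def\<close>)
  finally have le1: "(SUP (x, y) \<in> {(x, y). x \<noteq> y}. \<bar>\<psi> x - \<psi> y\<bar> / \<bar>x - y\<bar>) \<le> 1"
    using assms(2) unfolding bl_norm_def by linarith
  show "\<bar>\<psi> x - \<psi> y\<bar> \<le> \<bar>x - y\<bar>"
  proof (cases "x = y")
    case False
    \<comment> \<open>The constant \<open>C\<close> only ensures that the supremum of the quotients
      is an upper bound; the constant 1 comes from the norm.\<close>
    have "bdd_above ((\<lambda>(x, y). \<bar>\<psi> x - \<psi> y\<bar> / \<bar>x - y\<bar>) ` {(x, y). x \<noteq> y})"
      unfolding bdd_above_def
      by (rule exI[of _ C])
        (use lipschitz_onD[OF C] in \<open>auto simp: dist_real_def divide_le_eq\<close>)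
    from cSUP_upper[OF _ this, of "(x, y)"] False
    have "\<bar>\<psi> x - \<psi> y\<bar> / \<bar>x - y\<bar> \<le> (SUP (x, y) \<in> {(x, y). x \<noteq> y}. \<bar>\<psi> x - \<psi> y\<bar> / \<bar>x - y\<bar>)"
      by simp
    then have "\<bar>\<psi> x - \<psi> y\<bar> / \<bar>x - y\<bar> \<le> 1" using le1 by (rule order_trans)
    then show ?thesis using False by (simp add: divide_le_eq)
  qed simp
qed

text \<open>Both measures are images of the same \<open>\<Theta>\<close>, a coupling: each
  admissible \<psi> changes by at most \<open>d\<close> between the two image points of a
  parameter.\<close>

lemma d_BL_distr_le:
  assumes "finite_measure \<Theta>" and [measurable]: "X \<in> borel_measurable \<Theta>" "Y \<in> borel_measurable \<Theta>"
    and close: "\<And>\<theta>. \<theta> \<in> space \<Theta> \<Longrightarrow> \<bar>X \<theta> - Y \<theta>\<bar> \<le> d"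
  shows "d_BL (distr \<Theta> borel X) (distr \<Theta> borel Y) \<le> d * measure \<Theta> (space \<Theta>)"
  unfolding d_BL_def
proof (rule cSUP_least)
  \<comment> \<open>The zero function witnesses that the supremum is over a nonempty set.\<close>
  have "bl_function (\<lambda>_. 0)" "bl_norm (\<lambda>_. 0) \<le> 1"
  proof -
    have "(\<lambda>(x :: real, y :: real). 0 / \<bar>x - y\<bar>) = (\<lambda>_. 0)" by auto
    moreover have "{(x :: real, y). x \<noteq> y} \<noteq> {}" using zero_neq_one by blast
    ultimately show "bl_norm (\<lambda>_. 0) \<le> 1" by (simp add: bl_norm_def)
    show "bl_function (\<lambda>_. 0)" by (auto simp: bl_function_def lipschitz_on_def)
  qed
  then show "{\<psi>. bl_function \<psi> \<and> bl_norm \<psi> \<le> 1} \<noteq> {}" by blast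
next
  fix \<psi> assume "\<psi> \<in> {\<psi>. bl_function \<psi> \<and> bl_norm \<psi> \<le> 1}"
  then have psi: "bl_function \<psi>" "bl_norm \<psi> \<le> 1" by auto
  interpret finite_measure \<Theta> by fact
  note [measurable] = bl_functionD(3)[OF psi]
  obtain B where B: "\<And>x. \<bar>\<psi> x\<bar> \<le> B" using bl_functionD(2)[OF psi] by blast
  have i: "integrable \<Theta> (\<lambda>\<theta>. \<psi> (Z \<theta>))" if [measurable]: "Z \<in> borel_measurable \<Theta>" for Z
    by (rule integrable_const_bound[where B=B]) (auto simp: B)
  have "(LINT x|distr \<Theta> borel X. \<psi> x) - (LINT x|distr \<Theta> borel Y. \<psi> x)
      = (LINT \<theta>|\<Theta>. \<psi> (X \<theta>) - \<psi> (Y \<theta>))"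
    by (simp add: integral_distr i)
  also have "\<dots> \<le> (LINT \<theta>|\<Theta>. d)"
  proof (rule integral_mono)
    fix \<theta> assume "\<theta> \<in> space \<Theta>"
    then show "\<psi> (X \<theta>) - \<psi> (Y \<theta>) \<le> d"
      using bl_functionD(1)[OF psi, of "X \<theta>" "Y \<theta>"] close[of \<theta>] by linarith
  qed (auto intro!: Bochner_Integration.integrable_diff i)
  also have "\<dots> = d * measure \<Theta> (space \<Theta>)" by simp
  finally show "(LINT x|distr \<Theta> borel X. \<psi> x) - (LINT x|distr \<Theta> borel Y. \<psi> x)
      \<le> d * measure \<Theta> (space \<Theta>)" .
qed

theorem lemma5p2:
  fixes \<chi>p \<chi>m :: "real \<Rightarrow> real" and u0 :: "real \<Rightarrow> real" and \<mu>0 :: "real measure"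
    and t \<Delta>x :: real and s :: "int \<Rightarrow> real"
    and ut udt :: "real \<Rightarrow> real" and \<mu>t \<mu>dt :: "real measure"
  assumes "cutoff_pair \<chi>p \<chi>m"
    and "(u0, \<mu>0) \<in> eulerian_set \<chi>p \<chi>m"
    and "0 \<le> t"
    and "0 < \<Delta>x" and "\<Delta>x \<le> 1"
    and "\<And>j. s j \<in> {1, -1}"
    and "(ut, \<mu>t) = T_map t (u0, \<mu>0)"
    and "(udt, \<mu>dt) = (T_map t \<circ> P_map \<Delta>x s) (u0, \<mu>0)"
  shows "d_BL \<mu>t \<mu>dt
    \<le> (1 + 2 * sqrt 2) * t * (measure \<mu>0 UNIV) powr (3/2) * \<Delta>x powr (1/2)
      + (2 + 1/2 * t\<^sup>2 + 4 * exp (t/2)) * measure \<mu>0 UNIV * \<Delta>x"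
proof -
  note cut = assms(1) and E = eulerian_setD[OF assms(1,2)]
  define m where "m = measure \<mu>0 UNIV"
  let ?Fac = "dist_fun (ac_part \<mu>0)" and ?Fsing = "dist_fun (sing_part \<mu>0)"
  interpret M: finite_borel_measure \<mu>0 by (rule E(1))
  interpret Ac: finite_borel_measure "ac_part \<mu>0" by (rule E(3))
  interpret Sing: finite_borel_measure "sing_part \<mu>0" by (rule E(4))
  interpret projection \<Delta>x s u0 ?Fac ?Fsing
    by unfold_locales (use assms E Ac.dist_fun_mono Sing.dist_fun_mono in auto)
  have F_eq: "dist_fun \<mu>0 = F" using E(5) by (rule ext)
  obtain \<nu> where nu: "finite_borel_measure \<nu>" "dist_fun \<nu> = PF" "measure \<nu> UNIV = m"
    using ex_measure_of_dist_fun[of PF, OF PF_mono PF_left_continuous PF_at_bot PF_at_top, of m]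
      M.dist_fun_at_bot M.dist_fun_at_top unfolding F_eq m_def by blast
  interpret N: finite_borel_measure \<nu> by (rule nu(1))
  define ud where "ud = proj_u \<Delta>x s u0 ?Fac"
  \<comment> \<open>Uniqueness of the measure with a given distribution function identifies the
    definite description in \<open>P_map\<close>.\<close>
  have "measure_of_dist_fun PF = \<nu>"
    unfolding measure_of_dist_fun_def finite_borel_measure_on_R_iff
    by (rule the_equality) (use nu measure_eq_if_dist_fun_eq in auto)
  then have P: "P_map \<Delta>x s (u0, \<mu>0) = (ud, \<nu>)" by (simp add: P_map_def Let_def ud_def)
  have um: "u0 \<in> borel_measurable borel" by (rule borel_measurable_continuous_onI[OF E(2)])
  have udm: "ud \<in> borel_measurable borel" unfolding ud_def by measurable
  define Y where "Y \<rho> v \<theta> = quantile \<rho> \<theta> + t * v (quantile \<rho> \<theta>) + t\<^sup>2 / 4 * (\<theta> - m / 2)"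
    for \<rho> v \<theta>
  \<comment> \<open>Equality of total masses lets both solutions be parametrised by the same
    \<theta>, and makes their quadratic terms in t coincide.\<close>
  have labels: "labels \<nu> = labels \<mu>0" by (simp add: labels_def nu(3) m_def)
  have mut: "\<mu>t = distr (labels \<mu>0) borel (Y \<mu>0 u0)"
    using arg_cong[OF assms(7), of snd] M.snd_T_map[OF cut assms(3) um] by (simp add: Y_def[abs_def] m_def)
  have mudt: "\<mu>dt = distr (labels \<mu>0) borel (Y \<nu> ud)"
    using arg_cong[OF assms(8), of snd] N.snd_T_map[OF cut assms(3) udm]
    by (simp add: Y_def[abs_def] nu(3) labels P)
  \<comment> \<open>The first summand bounds the initial displacement within one cell, the second
    the velocity difference accumulated up to time t.\<close>
  define d where "d = 2 * \<Delta>x + t * ((1 + sqrt 2) * sqrt (\<Delta>x * m))"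
  have "\<bar>Y \<mu>0 u0 \<theta> - Y \<nu> ud \<theta>\<bar> \<le> d" if "\<theta> \<in> space (labels \<mu>0)" for \<theta>
  proof -
    have th: "0 < \<theta>" "\<theta> < m" using that by (auto simp: M.space_labels m_def)
    obtain j where j: "dist_fun \<mu>0 (x0 j) < \<theta>" "\<theta> \<le> dist_fun \<mu>0 (x2 j)"
      using M.ex_cell_quantile[OF h th[unfolded m_def]] by blast
    \<comment> \<open>The projected distribution function has the same values at both ends of the
      cell, so this cell also contains the quantile of \<open>\<nu>\<close>.\<close>
    have j': "dist_fun \<nu> (x0 j) < \<theta>" "\<theta> \<le> dist_fun \<nu> (x2 j)"
      using j unfolding nu(2) F_eq PF_x0 PF_x2 .
    define x y where "x = quantile \<mu>0 \<theta>" and "y = quantile \<nu> \<theta>"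
    have x: "x0 j \<le> x" "x \<le> x2 j" unfolding x_def
      using M.le_quantile[OF j(1)] M.quantile_le[OF j(2)] th by (auto simp: m_def)
    have y: "x0 j \<le> y" "y \<le> x2 j" unfolding y_def
      using N.le_quantile[OF j'(1)] N.quantile_le[OF j'(2)] th by (auto simp: nu(3))
    have "\<bar>u0 x - ud y\<bar> \<le> (1 + sqrt 2) * sqrt (\<Delta>x * m)"
      unfolding ud_def
    proof (rule proj_u_diff_bound[OF x y])
      fix a b
      have "?Fac b \<le> F b" using Sing.dist_fun_nonneg by simp
      also have "\<dots> \<le> m" using M.dist_fun_le[of b] by (simp add: F_eq m_def)
      finally show "?Fac b - ?Fac a \<le> m" using Ac.dist_fun_nonneg[of a] by linarith
    qed
    then have "\<bar>t * (u0 x - ud y)\<bar> \<le> t * ((1 + sqrt 2) * sqrt (\<Delta>x * m))"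
      using assms(3) by (simp add: abs_mult mult_left_mono)
    moreover have "\<bar>x - y\<bar> \<le> 2 * \<Delta>x" using x y unfolding grid by linarith
    moreover have "Y \<mu>0 u0 \<theta> - Y \<nu> ud \<theta> = (x - y) + t * (u0 x - ud y)"
      by (simp add: Y_def x_def y_def algebra_simps)
    ultimately show ?thesis unfolding d_def by linarith
  qed
  moreover have "Y \<mu>0 u0 \<in> borel_measurable (labels \<mu>0)" "Y \<nu> ud \<in> borel_measurable (labels \<mu>0)"
  proof -
    note [measurable] = um udm N.measurable_quantile[unfolded labels]
    show "Y \<mu>0 u0 \<in> borel_measurable (labels \<mu>0)" "Y \<nu> ud \<in> borel_measurable (labels \<mu>0)"
      unfolding Y_def by measurable
  qed
  ultimately have "d_BL \<mu>t \<mu>dt \<le> d * measure (labels \<mu>0) (space (labels \<mu>0))"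
    unfolding mut mudt by (intro d_BL_distr_le M.finite_labels)
  also have "measure (labels \<mu>0) (space (labels \<mu>0)) = m"
    by (simp add: M.space_labels measure_def M.emeasure_labels m_def)
  also have "d * m = 2 * \<Delta>x * m + (1 + sqrt 2) * t * (m powr (3/2) * \<Delta>x powr (1/2))"
  proof -
    have "sqrt (\<Delta>x * m) * m = m powr (3/2) * \<Delta>x powr (1/2)"
    proof (cases "m = 0")
      case False
      then have "0 < m" by (simp add: m_def order_less_le)
      then have "m powr (3/2) = m powr (1/2) * m powr 1"
        by (subst powr_add[symmetric]) simp
      then show ?thesis using \<open>0 < m\<close> h by (simp add: powr_half_sqrt real_sqrt_mult)
    qed simp
    moreover have "d * m = 2 * \<Delta>x * m + (1 + sqrt 2) * t * (sqrt (\<Delta>x * m) * m)"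
      by (simp add: d_def algebra_simps)
    ultimately show ?thesis by simp
  qed
  \<comment> \<open>Only coefficients are enlarged: \<open>sqrt 2\<close> to
    \<open>2 * sqrt 2\<close>, and 2 by the nonnegative terms in t.\<close>
  also have "\<dots> \<le> (1 + 2 * sqrt 2) * t * m powr (3/2) * \<Delta>x powr (1/2)
      + (2 + 1/2 * t\<^sup>2 + 4 * exp (t/2)) * m * \<Delta>x"
  proof -
    have "(1 + sqrt 2) * t * (m powr (3/2) * \<Delta>x powr (1/2))
        \<le> (1 + 2 * sqrt 2) * t * (m powr (3/2) * \<Delta>x powr (1/2))"
      using assms(3) by (intro mult_right_mono) auto
    moreover have "2 * (m * \<Delta>x) \<le> (2 + 1/2 * t\<^sup>2 + 4 * exp (t/2)) * (m * \<Delta>x)"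
      using h by (intro mult_right_mono) (auto simp: m_def)
    ultimately show ?thesis by (simp add: mult.assoc mult.commute mult.left_commute)
  qed
  finally show ?thesis by (simp only: m_def)
qed

end
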